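(* Let $d$ be a positive integer and $n$ a nonnegative integer. Assume that $\Theta$ is a $d\times d$ matrix-valued inner function on the bidisk $\mathbb{D}^2$ such that the compressed shift $S_{z_1}$ on $\mathcal{K}_\Theta$ satisfies $\operatorname{Rank}\,[S_{z_1},S_{z_1}^*]=n$. Then $$\dim \mathcal{H}(K^{max}_1)\le n.$$
   Context: Let $\mathbb{D}$ be the open unit disk and $\mathbb{T}$ the unit circle. A $d\times d$ matrix-valued function $\Theta$ on $\mathbb{D}^2$ is called inner if its entries are holomorphic on $\mathbb{D}^2$ and its boundary values satisfy $\Theta(\tau)\Theta(\tau)^*=\Theta(\tau)^*\Theta(\tau)=I_{d\times d}$ for a.e. $\tau\in\mathbb{T}^2$. Let $H^2_d(\mathbb{D}^2)= H^2(\mathbb{D}^2)\otimes\mathbb{C}^d$ be the $\mathbb{C}^d$-valued Hardy space on the bidisk, and let $\mathcal{K}_{\Theta}= H^2_d(\mathbb{D}^2)\ominus\Theta H^2_d(\mathbb{D}^2)$. Let $T_{z_1}$ denote multiplication by $z_1$ on $H^2_d(\mathbb{D}^2)$, let $P_\Theta$ be the orthogonal projection of $H^2_d(\mathbb{D}^2)$ onto $\mathcal{K}_\Theta$, and define the compressed shift $S_{z_1}= P_{\Theta}T_{z_1}|_{\mathcal{K}_{\Theta}}:\mathcal{K}_\Theta\to\mathcal{K}_\Theta$. The commutator is $[S_{z_1},S_{z_1}^*]=S_{z_1}S_{z_1}^*-S_{z_1}^*S_{z_1}$, and its rank is the dimension of its range. Let $\mathcal{S}^{max}_1$ be the maximal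 subspace of $\mathcal{K}_\Theta$ invariant under multiplication by $z_1$; that is, $\mathcal{S}^{max}_1$ is the set of $f$ with $z_1^k f\in\mathcal{K}_\Theta$ for all $k\in\mathbb{N}$ (including $k=0$). For a positive matrix-valued kernel $K:\mathbb{D}^2\times\mathbb{D}^2\to M_d(\mathbb{C})$, $\mathcal{H}(K)$ denotes the Hilbert space of $\mathbb{C}^d$-valued functions with reproducing kernel $K$. The kernel $K^{max}_1$ is the positive $M_d(\mathbb{C})$-valued kernel on $\mathbb{D}^2\times\mathbb{D}^2$ determined by $$\mathcal{S}^{max}_1=\mathcal{H}\left(\frac{K^{max}_1(z,w)}{1-z_1\bar w_1}\right),$$ where $\mathcal{S}^{max}_1$ carries the norm of $H^2_d(\mathbb{D}^2)$ (such a kernel is known to exist). Equivalently, $\mathcal{H}(K^{max}_1)=\mathcal{S}^{max}_1\ominus z_1\mathcal{S}^{max}_1$. *)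

theory Defs
  imports
    "HOL-Analysis.Analysis"
    "HOL-Library.Function_Algebras"
    "HOL-Library.Extended_Nat"
    "HOL-Library.Nonpos_Ints"
begin

text \<open>
  The dimension \<open>d\<close> is \<open>CARD('d)\<close>. A function on the bidisk is a total function on
  \<^typ>\<open>complex \<times> complex\<close>; members of spaces of functions are required to vanish off the
  bidisk, so that equality of such functions is equality on the bidisk.
\<close>

type_synonym 'd vfun = "complex \<times> complex \<Rightarrow> complex ^ 'd"
type_synonym 'd mfun = "complex \<times> complex \<Rightarrow> complex ^ 'd ^ 'd"
type_synonym 'd kernel = "complex \<times> complex \<Rightarrow> complex \<times> complex \<Rightarrow> complex ^ 'd ^ 'd"

definition bidisk :: "(complex \<times> complex) set" where
  "bidisk = ball 0 1 \<times> ball 0 1"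

definition cip :: "complex ^ 'd::finite \<Rightarrow> complex ^ 'd \<Rightarrow> complex" where
  "cip x y = (\<Sum>i\<in>UNIV. x $ i * cnj (y $ i))"


section \<open>Complex vector spaces of functions\<close>

definition vscale :: "complex \<Rightarrow> 'd::finite vfun \<Rightarrow> 'd vfun" where
  "vscale c f = (\<lambda>z. c *s f z)"

interpretation vfun: vector_space "vscale :: complex \<Rightarrow> 'd::finite vfun \<Rightarrow> 'd vfun"
  by unfold_locales (auto simp: vscale_def fun_eq_iff vec_eq_iff algebra_simps)

text \<open>The library dimension is \<open>0\<close> on infinite-dimensional spaces, hence the case distinction.\<close>

definition cdim :: "'d::finite vfun set \<Rightarrow> enat" where
  "cdim V = (if \<exists>B. finite B \<and> V \<subseteq> vfun.span B then enat (vfun.dim V) else \<infinity>)"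


section \<open>The Hardy space of the bidisk\<close>

definition square_summable :: "(nat \<times> nat \<Rightarrow> complex ^ 'd) \<Rightarrow> bool" where
  "square_summable a \<longleftrightarrow> (\<lambda>k. (norm (a k))\<^sup>2) summable_on UNIV"

definition power_series :: "(nat \<times> nat \<Rightarrow> complex ^ 'd::finite) \<Rightarrow> 'd vfun" where
  "power_series a = (\<lambda>z. if z \<in> bidisk
     then (\<Sum>\<^sub>\<infinity>(j, k)\<in>UNIV. (fst z ^ j * snd z ^ k) *s a (j, k)) else 0)"

definition H2 :: "'d::finite vfun set" where
  "H2 = {power_series a |a. square_summable a}"

definition taylor_coeff :: "'d::finite vfun \<Rightarrow> nat \<times> nat \<Rightarrow> complex ^ 'd" where
  "taylor_coeff f = (THE a. square_summable a \<and> f = power_series a)"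

definition H2_ip :: "'d::finite vfun \<Rightarrow> 'd vfun \<Rightarrow> complex" where
  "H2_ip f g = (\<Sum>\<^sub>\<infinity>k\<in>UNIV. cip (taylor_coeff f k) (taylor_coeff g k))"

definition orth_compl :: "'d::finite vfun set \<Rightarrow> 'd vfun set \<Rightarrow> 'd vfun set"
    (infixl "\<ominus>" 65) where
  "V \<ominus> M = {f \<in> V. \<forall>g\<in>M. H2_ip f g = 0}"

definition orth_proj :: "'d::finite vfun set \<Rightarrow> 'd vfun \<Rightarrow> 'd vfun" where
  "orth_proj V f = (THE g. g \<in> V \<and> (\<forall>h\<in>V. H2_ip (f - g) h = 0))"

definition hadjoint :: "'d::finite vfun set \<Rightarrow> ('d vfun \<Rightarrow> 'd vfun) \<Rightarrow> 'd vfun \<Rightarrow> 'd vfun" where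
  "hadjoint V A g = (THE h. h \<in> V \<and> (\<forall>f\<in>V. H2_ip (A f) g = H2_ip f h))"

definition mult_z1 :: "'d::finite vfun \<Rightarrow> 'd vfun" where
  "mult_z1 f = (\<lambda>z. fst z *s f z)"


section \<open>Inner functions\<close>

definition holomorphic2 :: "(complex \<times> complex \<Rightarrow> complex) \<Rightarrow> bool" where
  "holomorphic2 f \<longleftrightarrow>
     (\<forall>z\<in>bidisk. \<exists>a b. (f has_derivative (\<lambda>h. a * fst h + b * snd h)) (at z))"

definition conj_transpose :: "complex ^ 'd::finite ^ 'd \<Rightarrow> complex ^ 'd ^ 'd" where
  "conj_transpose A = (\<chi> i j. cnj (A $ j $ i))"

text \<open>
  Boundedness is implicit in speaking of boundary values and of \<open>\<Theta> H2\<close> as a subspace of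
  \<^term>\<open>H2\<close> (the multipliers of the Hardy space are the bounded holomorphic functions). Without
  it, \<open>exp ((1 + z\<^sub>1) / (1 - z\<^sub>1))\<close> would be inner. The boundary values are radial limits; the
  torus is parametrized by arguments.
\<close>

definition inner_function :: "'d::finite mfun \<Rightarrow> bool" where
  "inner_function \<Theta> \<longleftrightarrow>
     (\<forall>i j. holomorphic2 (\<lambda>z. \<Theta> z $ i $ j)) \<and> bounded (\<Theta> ` bidisk) \<and>
     (AE t in lebesgue_on ({0..2 * pi} \<times> {0..2 * pi}).
        \<exists>U. ((\<lambda>r. \<Theta> (of_real r * cis (fst t), of_real r * cis (snd t))) \<longlongrightarrow> U) (at_left 1) \<and>
            U ** conj_transpose U = mat 1 \<and> conj_transpose U ** U = mat 1)"


section \<open>The model space and the compressed shift\<close>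

definition model_space :: "'d::finite mfun \<Rightarrow> 'd vfun set" where
  "model_space \<Theta> = H2 \<ominus> (\<lambda>f z. \<Theta> z *v f z) ` H2"

definition compressed_shift :: "'d::finite mfun \<Rightarrow> 'd vfun \<Rightarrow> 'd vfun" where
  "compressed_shift \<Theta> f = orth_proj (model_space \<Theta>) (mult_z1 f)"

definition self_commutator :: "'d::finite vfun set \<Rightarrow> ('d vfun \<Rightarrow> 'd vfun) \<Rightarrow> 'd vfun \<Rightarrow> 'd vfun" where
  "self_commutator V A f = A (hadjoint V A f) - hadjoint V A (A f)"

definition oprank :: "'d::finite vfun set \<Rightarrow> ('d vfun \<Rightarrow> 'd vfun) \<Rightarrow> enat" where
  "oprank V A = cdim (A ` V)"

definition S1max :: "'d::finite mfun \<Rightarrow> 'd vfun set" where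
  "S1max \<Theta> = {f. \<forall>k. (mult_z1 ^^ k) f \<in> model_space \<Theta>}"


section \<open>Reproducing kernel Hilbert spaces\<close>

definition positive_kernel :: "'d::finite kernel \<Rightarrow> bool" where
  "positive_kernel K \<longleftrightarrow>
     (\<forall>z w. (z, w) \<notin> bidisk \<times> bidisk \<longrightarrow> K z w = 0) \<and>
     (\<forall>(N::nat) w \<eta>. (\<forall>i<N. w i \<in> bidisk) \<longrightarrow>
        (\<Sum>i<N. \<Sum>j<N. cip (K (w i) (w j) *v \<eta> j) (\<eta> i)) \<in> \<real>\<^sub>\<ge>\<^sub>0)"

definition hilbert_space_on :: "'d::finite vfun set \<Rightarrow> ('d vfun \<Rightarrow> 'd vfun \<Rightarrow> complex) \<Rightarrow> bool" where
  "hilbert_space_on V ip \<longleftrightarrow>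
     vfun.subspace V \<and>
     (\<forall>f\<in>V. \<forall>g\<in>V. \<forall>h\<in>V. ip (f + g) h = ip f h + ip g h) \<and>
     (\<forall>c. \<forall>f\<in>V. \<forall>g\<in>V. ip (vscale c f) g = c * ip f g) \<and>
     (\<forall>f\<in>V. \<forall>g\<in>V. ip g f = cnj (ip f g)) \<and>
     (\<forall>f\<in>V. ip f f \<in> \<real>\<^sub>\<ge>\<^sub>0 \<and> (ip f f = 0 \<longrightarrow> f = 0)) \<and>
     (\<forall>X :: nat \<Rightarrow> 'd vfun. range X \<subseteq> V \<and>
        (\<forall>e>0. \<exists>N. \<forall>m\<ge>N. \<forall>n\<ge>N. sqrt (Re (ip (X m - X n) (X m - X n))) < e) \<longrightarrow>
        (\<exists>L\<in>V. (\<lambda>n. sqrt (Re (ip (X n - L) (X n - L)))) \<longlonglongrightarrow> 0))"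

definition has_reproducing_kernel ::
    "'d::finite vfun set \<Rightarrow> ('d vfun \<Rightarrow> 'd vfun \<Rightarrow> complex) \<Rightarrow> 'd kernel \<Rightarrow> bool" where
  "has_reproducing_kernel V ip K \<longleftrightarrow>
     hilbert_space_on V ip \<and>
     (\<forall>f\<in>V. \<forall>z. z \<notin> bidisk \<longrightarrow> f z = 0) \<and>
     (\<forall>w\<in>bidisk. \<forall>\<eta>. (\<lambda>z. K z w *v \<eta>) \<in> V \<and>
        (\<forall>f\<in>V. ip f (\<lambda>z. K z w *v \<eta>) = cip (f w) \<eta>))"

text \<open>
  The space underlying \<open>\<H>(K)\<close>. The space and its inner product are determined by the positive
  kernel \<open>K\<close> (Moore--Aronszajn), but the function \<open>ip\<close> is arbitrary off the space.
\<close>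

definition RKHS :: "'d::finite kernel \<Rightarrow> 'd vfun set" where
  "RKHS K = (THE V. \<exists>ip. has_reproducing_kernel V ip K)"

definition K1max :: "'d::finite mfun \<Rightarrow> 'd kernel" where
  "K1max \<Theta> = (THE K. positive_kernel K \<and>
     has_reproducing_kernel (S1max \<Theta>) H2_ip
       (\<lambda>z w. \<chi> i j. K z w $ i $ j / (1 - fst z * cnj (fst w))))"

end

theory Submission
  imports Defs "HOL-Complex_Analysis.Cauchy_Integral_Formula"
begin

text \<open>
  Write \<open>T\<close> for multiplication by \<open>z\<^sub>1\<close> on the Hardy space and \<open>T*\<close> for its adjoint, the backward
  shift; let \<open>K\<close> be the model space, \<open>P\<close> the projection onto it, \<open>S\<close> the largest \<open>T\<close>-invariant
  subspace of \<open>K\<close> and \<open>W = S \<ominus> T S\<close>. The theorem holds because the self-commutator of the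
  compressed shift is injective on \<open>W\<close>, and \<open>W\<close> is the space whose dimension is asked for.

  Injectivity. \<open>K\<close> is invariant under \<open>T*\<close>, so the adjoint of the compressed shift is the
  restriction of \<open>T*\<close>, and the commutator is \<open>f \<mapsto> P T T* f - T* P T f\<close>. For \<open>f\<close> in \<open>W\<close> the function
  \<open>T f\<close> lies in \<open>S\<close>, hence in \<open>K\<close>, and the second term is \<open>T* T f = f\<close>. If the commutator kills
  \<open>f\<close>, then \<open>f = P T T* f\<close>; pairing with \<open>f\<close> gives \<open>\<parallel>f\<parallel>\<^sup>2 = \<parallel>T* f\<parallel>\<^sup>2\<close>, and as \<open>T T*\<close> is a projection,
  \<open>f = T T* f\<close>. Now \<open>T* f\<close> lies in \<open>K\<close> and its product with \<open>z\<^sub>1\<close> in \<open>S\<close>, so \<open>T* f\<close> itself lies in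
  \<open>S\<close>. Thus \<open>f\<close> belongs to \<open>T S\<close> and is orthogonal to \<open>T S\<close>, so \<open>f = 0\<close>
  (\<open>commutator_injective_on_W\<close>, \<open>cdim_le_if_injective\<close>).

  Identification of \<open>W\<close>. If \<open>k\<close> is the reproducing kernel of \<open>S\<close>, then \<open>(1 - z\<^sub>1 w\<^sub>1*) k(z, w)\<close>, with
  \<open>w\<^sub>1*\<close> the complex conjugate of \<open>w\<^sub>1\<close>, reproduces the values of the functions in \<open>W\<close>, and a
  kernel determines its space (\<open>RKHS_K1max\<close>, \<open>RKHS_eq\<close>).

  Behind both parts stand two facts about the Hardy space: it is a Hilbert space
  (\<open>hilbert_space_on_H2\<close>), and \<open>\<Theta>\<close> maps it into itself (\<open>inner_function_multiplier\<close>). The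
  latter makes \<open>T*\<close>-invariance of \<open>K\<close> meaningful: a product \<open>\<Theta> f\<close> is first expanded into a double
  power series by Cauchy's theory in each variable, and its coefficients are then shown to be square
  summable by comparing quadratic means of \<open>\<Theta> f\<close> and \<open>f\<close> over tori.
\<close>


section \<open>The standard inner product on coordinate space\<close>

lemma cip_add_left: "cip (x + y) z = cip x z + cip y z"
  by (simp add: cip_def sum.distrib algebra_simps)

lemma cip_scale_left: "cip (c *s x) y = c * cip x y"
  by (simp add: cip_def sum_distrib_left algebra_simps)

lemma cip_commute: "cip y x = cnj (cip x y)"
  by (simp add: cip_def mult.commute)

lemma cip_self: "cip x x = of_real ((norm x)\<^sup>2)"
  by (simp add: cip_def norm_vec_def L2_set_def real_sqrt_pow2 sum_nonneg flip: complex_norm_square)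

lemma norm_squared_vec: "(norm (x :: complex ^ 'd))\<^sup>2 = (\<Sum>i\<in>UNIV. (norm (x $ i))\<^sup>2)"
  unfolding norm_vec_def L2_set_def by (rule real_sqrt_pow2) (rule sum_nonneg, simp)

lemma cip_zero_left: "cip 0 y = 0"
  by (simp add: cip_def)

lemma cip_nondegenerate:
  assumes "\<And>\<eta>. cip x \<eta> = 0"
  shows "x = 0"
  using assms[of x] by (simp add: cip_self)

lemma norm_cip_le: "norm (cip x y) \<le> (norm x)\<^sup>2 + (norm y)\<^sup>2"
proof -
  have "norm (cip x y) \<le> (\<Sum>i\<in>UNIV. norm (x $ i) * norm (y $ i))"
    unfolding cip_def by (rule order_trans[OF norm_sum]) (simp add: norm_mult)
  also have "\<dots> \<le> (\<Sum>i\<in>UNIV. (norm (x $ i))\<^sup>2 + (norm (y $ i))\<^sup>2)"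
  proof (rule sum_mono)
    fix i
    have "2 * (norm (x $ i) * norm (y $ i)) \<le> (norm (x $ i))\<^sup>2 + (norm (y $ i))\<^sup>2"
      using sum_squares_bound[of "norm (x $ i)" "norm (y $ i)"] by (simp add: algebra_simps)
    moreover have "0 \<le> norm (x $ i) * norm (y $ i)" by simp
    ultimately show "norm (x $ i) * norm (y $ i) \<le> (norm (x $ i))\<^sup>2 + (norm (y $ i))\<^sup>2"
      by linarith
  qed
  also have "\<dots> = (norm x)\<^sup>2 + (norm y)\<^sup>2"
    by (simp add: norm_squared_vec sum.distrib)
  finally show ?thesis .
qed


section \<open>Hilbert spaces of functions\<close>

locale function_hilbert_space =
  fixes V :: "'d::finite vfun set" and ip :: "'d vfun \<Rightarrow> 'd vfun \<Rightarrow> complex"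
  assumes hilbert: "hilbert_space_on V ip"
begin

definition nsq :: "'d vfun \<Rightarrow> real" where
  "nsq f = Re (ip f f)"

definition conv :: "(nat \<Rightarrow> 'd vfun) \<Rightarrow> 'd vfun \<Rightarrow> bool" where
  "conv X L \<longleftrightarrow> (\<lambda>n. nsq (X n - L)) \<longlonglongrightarrow> 0"

lemma subspace_V: "vfun.subspace V"
  using hilbert by (simp add: hilbert_space_on_def)

lemma zero_mem [simp]: "0 \<in> V"
  by (rule vfun.subspace_0[OF subspace_V])

lemma add_mem [simp]: "f \<in> V \<Longrightarrow> g \<in> V \<Longrightarrow> f + g \<in> V"
  by (rule vfun.subspace_add[OF subspace_V])

lemma diff_mem [simp]: "f \<in> V \<Longrightarrow> g \<in> V \<Longrightarrow> f - g \<in> V"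
  by (rule vfun.subspace_diff[OF subspace_V])

lemma scale_mem [simp]: "f \<in> V \<Longrightarrow> vscale c f \<in> V"
  by (rule vfun.subspace_scale[OF subspace_V])

lemmas hilbert_axioms = hilbert[unfolded hilbert_space_on_def, folded nsq_def]
lemmas hilbert_add = hilbert_axioms[THEN conjunct2, THEN conjunct1]
  and hilbert_scale = hilbert_axioms[THEN conjunct2, THEN conjunct2, THEN conjunct1]
  and hilbert_commute = hilbert_axioms[THEN conjunct2, THEN conjunct2, THEN conjunct2, THEN conjunct1]
  and hilbert_definite = hilbert_axioms[THEN conjunct2, THEN conjunct2, THEN conjunct2, THEN conjunct2,
    THEN conjunct1]
  and hilbert_complete = hilbert_axioms[THEN conjunct2, THEN conjunct2, THEN conjunct2, THEN conjunct2,
    THEN conjunct2]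

lemma ip_add_left: "f \<in> V \<Longrightarrow> g \<in> V \<Longrightarrow> h \<in> V \<Longrightarrow> ip (f + g) h = ip f h + ip g h"
  and ip_scale_left: "f \<in> V \<Longrightarrow> g \<in> V \<Longrightarrow> ip (vscale c f) g = c * ip f g"
  by (simp_all add: hilbert_add hilbert_scale)

lemma ip_commute: "f \<in> V \<Longrightarrow> g \<in> V \<Longrightarrow> ip g f = cnj (ip f g)"
  using hilbert_commute by blast

lemma ip_add_right: "f \<in> V \<Longrightarrow> g \<in> V \<Longrightarrow> h \<in> V \<Longrightarrow> ip f (g + h) = ip f g + ip f h"
  using ip_commute[of "g + h" f] ip_commute[of g f] ip_commute[of h f] by (simp add: ip_add_left)

lemma ip_scale_right: "f \<in> V \<Longrightarrow> g \<in> V \<Longrightarrow> ip f (vscale c g) = cnj c * ip f g"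
  using ip_commute[of "vscale c g" f] ip_commute[of g f] by (simp add: ip_scale_left)

lemma ip_diff_left: "f \<in> V \<Longrightarrow> g \<in> V \<Longrightarrow> h \<in> V \<Longrightarrow> ip (f - g) h = ip f h - ip g h"
  using ip_add_left[of "f - g" g h] by simp

lemma ip_diff_right: "f \<in> V \<Longrightarrow> g \<in> V \<Longrightarrow> h \<in> V \<Longrightarrow> ip f (g - h) = ip f g - ip f h"
  using ip_add_right[of f "g - h" h] by simp

lemma ip_zero_left [simp]: "f \<in> V \<Longrightarrow> ip 0 f = 0"
  and ip_zero_right [simp]: "f \<in> V \<Longrightarrow> ip f 0 = 0"
  using ip_diff_left[of f f f] ip_diff_right[of f f f] by simp_all

lemma ip_self_nonneg: "f \<in> V \<Longrightarrow> ip f f \<in> \<real>\<^sub>\<ge>\<^sub>0"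
  and ip_self_eq_0: "f \<in> V \<Longrightarrow> ip f f = 0 \<Longrightarrow> f = 0"
  using hilbert_definite by blast+

lemma sum_mem: "(\<And>j. j \<in> J \<Longrightarrow> x j \<in> V) \<Longrightarrow> sum x J \<in> V"
  by (rule vfun.subspace_sum[OF subspace_V])

lemma ip_sum_left:
  assumes "finite J" "\<And>j. j \<in> J \<Longrightarrow> x j \<in> V" "f \<in> V"
  shows "ip (sum x J) f = (\<Sum>j\<in>J. ip (x j) f)"
  using assms(1,2)
proof (induction J)
  case empty
  show ?case
    unfolding sum.empty by (rule ip_zero_left[OF assms(3)])
next
  case (insert j J)
  have "ip (x j + sum x J) f = ip (x j) f + ip (sum x J) f"
    using insert.prems assms(3) by (intro ip_add_left sum_mem) auto
  also have "ip (sum x J) f = (\<Sum>j\<in>J. ip (x j) f)"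
    using insert.prems by (intro insert.IH) auto
  finally show ?case
    unfolding sum.insert[OF insert.hyps] .
qed

lemma ip_sum_right:
  assumes "finite J" "\<And>j. j \<in> J \<Longrightarrow> x j \<in> V" "f \<in> V"
  shows "ip f (sum x J) = (\<Sum>j\<in>J. ip f (x j))"
proof -
  have "sum x J \<in> V"
    using assms(2) by (rule sum_mem)
  then have "ip f (sum x J) = cnj (ip (sum x J) f)"
    using assms(3) by (rule ip_commute)
  also have "ip (sum x J) f = (\<Sum>j\<in>J. ip (x j) f)"
    using assms by (rule ip_sum_left)
  also have "cnj \<dots> = (\<Sum>j\<in>J. ip f (x j))"
    unfolding cnj_sum by (intro sum.cong refl ip_commute[symmetric] assms)
  finally show ?thesis .
qed

lemma nsq_nonneg [simp]: "f \<in> V \<Longrightarrow> 0 \<le> nsq f"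
  and ip_self: "f \<in> V \<Longrightarrow> ip f f = of_real (nsq f)"
  using ip_self_nonneg[of f] by (simp_all add: nsq_def complex_nonneg_Reals_iff complex_eq_iff)

lemma nsq_eq_0_iff: "f \<in> V \<Longrightarrow> nsq f = 0 \<longleftrightarrow> f = 0"
  using ip_self[of f] ip_self_eq_0[of f] by (auto simp: nsq_def)

lemma nsq_add: "f \<in> V \<Longrightarrow> g \<in> V \<Longrightarrow> nsq (f + g) = nsq f + nsq g + 2 * Re (ip f g)"
  using ip_commute[of f g] by (simp add: nsq_def ip_add_left ip_add_right)

lemma nsq_diff: "f \<in> V \<Longrightarrow> g \<in> V \<Longrightarrow> nsq (f - g) = nsq f + nsq g - 2 * Re (ip f g)"
  using ip_commute[of f g] by (simp add: nsq_def ip_diff_left ip_diff_right)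

lemma nsq_scale:
  assumes "f \<in> V"
  shows "nsq (vscale c f) = (norm c)\<^sup>2 * nsq f"
proof -
  have "ip (vscale c f) (vscale c f) = (c * cnj c) * of_real (nsq f)"
    by (simp only: ip_scale_left[OF assms scale_mem[OF assms]] ip_scale_right[OF assms assms] ip_self[OF assms] mult.assoc)
  also have "\<dots> = of_real ((norm c)\<^sup>2 * nsq f)"
    by (simp only: complex_norm_square of_real_mult)
  finally show ?thesis
    by (simp add: nsq_def)
qed

lemma nsq_diff_commute: "f \<in> V \<Longrightarrow> g \<in> V \<Longrightarrow> nsq (f - g) = nsq (g - f)"
  using ip_commute[of f g] by (simp add: nsq_diff)

text \<open>Removing from \<open>f\<close> its component along \<open>h\<close> lowers the squared norm by the squared
  modulus of the coefficient; both the Cauchy--Schwarz inequality and the characterization of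
  best approximations by orthogonality are read off from this.\<close>

lemma nsq_remove_component:
  assumes "f \<in> V" "h \<in> V" "h \<noteq> 0"
  shows "nsq (f - vscale (ip f h / of_real (nsq h)) h) = nsq f - (norm (ip f h))\<^sup>2 / nsq h"
proof -
  have nz: "nsq h \<noteq> 0"
    using assms by (simp add: nsq_eq_0_iff)
  have "cnj (ip f h / of_real (nsq h)) * ip f h = of_real ((norm (ip f h))\<^sup>2 / nsq h)"
    using complex_norm_square[of "ip f h"] by (simp add: mult.commute)
  then show ?thesis
    using assms nz
    by (simp add: nsq_diff nsq_scale ip_scale_right norm_divide power_divide power2_eq_square)
qed

lemma Cauchy_Schwarz:
  assumes "f \<in> V" "g \<in> V"
  shows "(norm (ip f g))\<^sup>2 \<le> nsq f * nsq g"
proof (cases "g = 0")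
  case False
  then have "nsq g > 0"
    using assms nsq_eq_0_iff[of g] nsq_nonneg[of g] by linarith
  moreover have "0 \<le> nsq f - (norm (ip f g))\<^sup>2 / nsq g"
    using nsq_remove_component[OF assms False] nsq_nonneg assms by (metis diff_mem scale_mem)
  ultimately show ?thesis
    by (simp add: field_simps)
qed (use assms in \<open>simp add: nsq_def\<close>)

lemma norm_ip_le: "f \<in> V \<Longrightarrow> g \<in> V \<Longrightarrow> norm (ip f g) \<le> sqrt (nsq f) * sqrt (nsq g)"
  using Cauchy_Schwarz[of f g] by (metis real_le_rsqrt real_sqrt_mult)

lemma conv_imp_ip_tendsto:
  assumes "conv X L" "\<And>n. X n \<in> V" "L \<in> V" "h \<in> V"
  shows "(\<lambda>n. ip (X n) h) \<longlonglongrightarrow> ip L h"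
proof -
  have "(\<lambda>n. sqrt (nsq (X n - L)) * sqrt (nsq h)) \<longlonglongrightarrow> sqrt 0 * sqrt (nsq h)"
    using assms(1) unfolding conv_def by (intro tendsto_intros)
  then have "(\<lambda>n. sqrt (nsq (X n - L)) * sqrt (nsq h)) \<longlonglongrightarrow> 0"
    by simp
  then have "(\<lambda>n. ip (X n) h - ip L h) \<longlonglongrightarrow> 0"
  proof (rule Lim_null_comparison[rotated])
    show "\<forall>\<^sub>F n in sequentially. norm (ip (X n) h - ip L h) \<le> sqrt (nsq (X n - L)) * sqrt (nsq h)"
      using norm_ip_le[of "X _ - L" h] assms by (simp add: ip_diff_left)
  qed
  then show ?thesis
    by (simp add: LIM_zero_iff)
qed

lemma conv_imp_nsq_tendsto:
  assumes "conv X L" "\<And>n. X n \<in> V" "L \<in> V"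
  shows "(\<lambda>n. nsq (X n)) \<longlonglongrightarrow> nsq L"
proof -
  have "nsq (X n) = nsq (X n - L) + nsq L + 2 * Re (ip (X n - L) L)" for n
    using nsq_add[of "X n - L" L] assms by simp
  moreover have "(\<lambda>n. nsq (X n - L) + nsq L + 2 * Re (ip (X n - L) L)) \<longlonglongrightarrow>
      0 + nsq L + 2 * Re (ip L L - ip L L)"
    using assms(1) conv_imp_ip_tendsto[OF assms \<open>L \<in> V\<close>] assms
    by (simp only: ip_diff_left) (intro tendsto_intros, auto simp: conv_def)
  ultimately show ?thesis by simp
qed

lemma conv_diff:
  assumes "conv X L"
  shows "conv (\<lambda>n. X n - f) (L - f)"
  using assms by (simp add: conv_def)

lemma conv_diff_left:
  assumes "conv X L" "\<And>n. X n \<in> V" "L \<in> V" "f \<in> V"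
  shows "conv (\<lambda>n. f - X n) (f - L)"
proof -
  have "nsq (f - X n - (f - L)) = nsq (X n - L)" for n
    using nsq_diff_commute[of L "X n"] assms by (simp add: algebra_simps)
  then show ?thesis
    using assms(1) by (simp add: conv_def)
qed

lemma complete:
  assumes "\<And>n. X n \<in> V" "\<And>e. e > 0 \<Longrightarrow> \<exists>N. \<forall>m\<ge>N. \<forall>n\<ge>N. nsq (X m - X n) < e"
  obtains L where "L \<in> V" "conv X L"
proof -
  have "\<exists>N. \<forall>m\<ge>N. \<forall>n\<ge>N. sqrt (nsq (X m - X n)) < e" if "e > 0" for e :: real
  proof -
    have "sqrt x < e" if "x < e\<^sup>2" for x :: real
      using that \<open>e > 0\<close> real_sqrt_less_mono by fastforce
    then show ?thesis
      using assms(2)[of "e\<^sup>2"] that by (meson zero_less_power)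
  qed
  then obtain L where L: "L \<in> V" "(\<lambda>n. sqrt (nsq (X n - L))) \<longlonglongrightarrow> 0"
    using hilbert_complete assms(1) by (metis image_subsetI)
  have "(\<lambda>n. (sqrt (nsq (X n - L)))\<^sup>2) \<longlonglongrightarrow> 0\<^sup>2"
    using L(2) by (intro tendsto_power)
  then have "conv X L"
    using L(1) assms(1) by (simp add: conv_def)
  with L(1) show ?thesis by (rule that)
qed

lemma conv_imp_Cauchy:
  assumes "conv X L" "\<And>n. X n \<in> V" "L \<in> V" "e > 0"
  shows "\<exists>N. \<forall>m\<ge>N. \<forall>n\<ge>N. nsq (X m - X n) < e"
proof -
  have "\<forall>\<^sub>F n in sequentially. nsq (X n - L) < e / 4"
    using assms(1,4) unfolding conv_def by (intro order_tendstoD(2)[where y = 0]) auto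
  then obtain N where N: "\<And>n. n \<ge> N \<Longrightarrow> nsq (X n - L) < e / 4"
    by (auto simp: eventually_sequentially)
  have "nsq (X m - X n) < e" if "m \<ge> N" "n \<ge> N" for m n
  proof -
    let ?a = "X m - L" and ?b = "X n - L"
    have "nsq (?a - ?b) + nsq (?a + ?b) = 2 * nsq ?a + 2 * nsq ?b"
      using nsq_diff[of ?a ?b] nsq_add[of ?a ?b] assms by simp
    moreover have "nsq (?a + ?b) \<ge> 0"
      by (intro nsq_nonneg add_mem diff_mem assms)
    moreover have "?a - ?b = X m - X n"
      by simp
    ultimately show ?thesis
      using N[OF that(1)] N[OF that(2)] by auto
  qed
  then show ?thesis by blast
qed

text \<open>For a subspace \<open>M\<close> that need not be closed, the best approximation of \<open>f\<close> is only a limit of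
  elements of \<open>M\<close>. A minimizing sequence is Cauchy by the parallelogram law, because the midpoint of
  two of its terms is again a competitor. This form gives both projections onto closed subspaces
  and density of the span of the kernel functions.\<close>

theorem approximate_projection:
  assumes M: "vfun.subspace M" "M \<subseteq> V" and f: "f \<in> V"
  obtains X g where "\<And>n. X n \<in> M" "g \<in> V" "conv X g" "\<And>h. h \<in> M \<Longrightarrow> ip (f - g) h = 0"
proof -
  define D where "D = (\<lambda>g. nsq (f - g)) ` M"
  define \<delta> where "\<delta> = Inf D"
  have M0: "0 \<in> M" and MV: "g \<in> M \<Longrightarrow> g \<in> V" for g
    using M by (auto simp: vfun.subspace_0)
  have "bdd_below D"
    by (rule bdd_belowI[of _ 0]) (use f MV in \<open>auto simp: D_def\<close>)
  then have \<delta>_le: "\<delta> \<le> nsq (f - g)" if "g \<in> M" for g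
    using that by (auto simp: \<delta>_def D_def intro: cInf_lower)
  have "\<exists>g\<in>M. nsq (f - g) < \<delta> + 1 / Suc n" for n
    using cInf_lessD[of D "\<delta> + 1 / Suc n"] M0 unfolding \<delta>_def[symmetric]
    by (auto simp: D_def)
  then obtain X where X: "\<And>n. X n \<in> M" "\<And>n. nsq (f - X n) < \<delta> + 1 / Suc n"
    by metis
  have Cauchy: "nsq (X m - X n) < 2 / Suc m + 2 / Suc n" for m n
  proof -
    let ?a = "f - X m" and ?b = "f - X n"
    let ?c = "vscale (1/2) (X m + X n)"
    have c: "?c \<in> M"
      using M X by (intro vfun.subspace_scale vfun.subspace_add)
    have "vscale 2 (f - ?c) = ?a + ?b"
      by (auto simp: vscale_def fun_eq_iff vec_eq_iff algebra_simps)
    then have "nsq (?a + ?b) = 4 * nsq (f - ?c)"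
      using nsq_scale[of "f - ?c" 2] f MV[OF c] by simp
    moreover have "nsq (?a - ?b) + nsq (?a + ?b) = 2 * nsq ?a + 2 * nsq ?b"
      using nsq_diff[of ?a ?b] nsq_add[of ?a ?b] f X MV by simp
    moreover have "nsq (?a - ?b) = nsq (X m - X n)"
      using nsq_diff_commute[of "X n" "X m"] X MV by (simp add: algebra_simps)
    ultimately show ?thesis
      using X(2)[of m] X(2)[of n] \<delta>_le[OF c] by simp
  qed
  have "\<exists>N. \<forall>m\<ge>N. \<forall>n\<ge>N. nsq (X m - X n) < e" if "e > 0" for e
  proof -
    obtain N where N: "1 / Suc N < e / 4"
      using \<open>e > 0\<close> nat_approx_posE[of "e / 4"] by auto
    have "nsq (X m - X n) < e" if "m \<ge> N" "n \<ge> N" for m n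
    proof -
      have "2 / Suc m \<le> 2 / Suc N" "2 / Suc n \<le> 2 / Suc N"
        using that by (auto intro!: divide_left_mono)
      with Cauchy[of m n] N show ?thesis by simp
    qed
    then show ?thesis by blast
  qed
  then obtain g where g: "g \<in> V" "conv X g"
    using complete[of X] X(1) MV by metis
  have lim: "(\<lambda>n. nsq (f - X n)) \<longlonglongrightarrow> nsq (f - g)"
    by (rule conv_imp_nsq_tendsto[OF conv_diff_left]) (use g f X MV in auto)
  have "nsq (f - g) \<le> \<delta> + 0"
  proof (rule LIMSEQ_le[OF lim])
    show "(\<lambda>n. \<delta> + 1 / Suc n) \<longlonglongrightarrow> \<delta> + 0"
      using LIMSEQ_Suc[OF lim_1_over_n] by (intro tendsto_intros) simp
  qed (use X(2) in \<open>auto intro: less_imp_le\<close>)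
  \<comment> \<open>Minimality passes to the limit \<open>g\<close>, also for perturbations by elements of \<open>M\<close>.\<close>
  have min: "nsq (f - g) \<le> nsq (f - g - vscale c h)" if h: "h \<in> M" for c h
  proof -
    have "conv (\<lambda>n. f - X n - vscale c h) (f - g - vscale c h)"
      by (intro conv_diff conv_diff_left) (use g f X MV in auto)
    then have "(\<lambda>n. nsq (f - X n - vscale c h)) \<longlonglongrightarrow> nsq (f - g - vscale c h)"
      by (rule conv_imp_nsq_tendsto) (use g f X h MV in auto)
    then have "\<delta> \<le> nsq (f - g - vscale c h)"
    proof (rule LIMSEQ_le_const, intro exI allI impI)
      fix n
      have "X n + vscale c h \<in> M"
        using M X h by (intro vfun.subspace_scale vfun.subspace_add)
      then show "\<delta> \<le> nsq (f - X n - vscale c h)"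
        using \<delta>_le by (metis diff_diff_add)
    qed
    with \<open>nsq (f - g) \<le> \<delta> + 0\<close> show ?thesis by simp
  qed
  have "ip (f - g) h = 0" if h: "h \<in> M" for h
  proof (cases "h = 0")
    case False
    have "nsq h > 0"
      using False h MV nsq_eq_0_iff[of h] nsq_nonneg[of h] by fastforce
    moreover have "nsq (f - g) \<le> nsq (f - g) - (norm (ip (f - g) h))\<^sup>2 / nsq h"
      using min[OF h] nsq_remove_component[OF diff_mem[OF f g(1)] MV[OF h] False] by metis
    ultimately show ?thesis
      by (simp add: divide_le_0_iff)
  qed (use f g in simp)
  with X(1) g show ?thesis by (rule that)
qed

lemma hilbert_space_on_closed_subspace:
  assumes "vfun.subspace M" "M \<subseteq> V"
    and closed: "\<And>X L. (\<And>n. X n \<in> M) \<Longrightarrow> L \<in> V \<Longrightarrow> conv X L \<Longrightarrow> L \<in> M"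
  shows "hilbert_space_on M ip"
proof -
  have M: "f \<in> M \<Longrightarrow> f \<in> V" for f
    using assms(2) by auto
  have "\<exists>L\<in>M. (\<lambda>n. sqrt (nsq (X n - L))) \<longlonglongrightarrow> 0"
    if X: "range X \<subseteq> M"
      and C: "\<forall>e>0. \<exists>N. \<forall>m\<ge>N. \<forall>n\<ge>N. sqrt (nsq (X m - X n)) < e" for X :: "nat \<Rightarrow> 'd vfun"
  proof -
    have "range X \<subseteq> V"
      using X M by auto
    then obtain L where L: "L \<in> V" "(\<lambda>n. sqrt (nsq (X n - L))) \<longlonglongrightarrow> 0"
      using C hilbert_complete by blast
    have "(\<lambda>n. (sqrt (nsq (X n - L)))\<^sup>2) \<longlonglongrightarrow> 0\<^sup>2"
      using L(2) by (intro tendsto_power)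
    moreover have "X n \<in> V" for n
      using X M by auto
    ultimately have "conv X L"
      using L(1) by (simp add: conv_def)
    then have "L \<in> M"
      using closed[of X L] X L(1) by auto
    with L(2) show ?thesis
      by blast
  qed
  then have "\<forall>X :: nat \<Rightarrow> 'd vfun. range X \<subseteq> M \<and>
        (\<forall>e>0. \<exists>N. \<forall>m\<ge>N. \<forall>n\<ge>N. sqrt (nsq (X m - X n)) < e) \<longrightarrow>
        (\<exists>L\<in>M. (\<lambda>n. sqrt (nsq (X n - L))) \<longlonglongrightarrow> 0)"
    by blast
  moreover have "\<forall>f\<in>M. \<forall>g\<in>M. \<forall>h\<in>M. ip (f + g) h = ip f h + ip g h"
    by (intro ballI ip_add_left M)
  moreover have "\<forall>c. \<forall>f\<in>M. \<forall>g\<in>M. ip (vscale c f) g = c * ip f g"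
    by (intro ballI allI ip_scale_left M)
  moreover have "\<forall>f\<in>M. \<forall>g\<in>M. ip g f = cnj (ip f g)"
    by (intro ballI ip_commute M)
  moreover have "\<forall>f\<in>M. ip f f \<in> \<real>\<^sub>\<ge>\<^sub>0 \<and> (ip f f = 0 \<longrightarrow> f = 0)"
    by (intro ballI conjI impI ip_self_nonneg ip_self_eq_0 M)
  ultimately show ?thesis
    unfolding hilbert_space_on_def nsq_def[symmetric] using assms(1) by (intro conjI)
qed

text \<open>Completeness of \<open>M\<close> puts the limit of a minimizing sequence back into \<open>M\<close>.\<close>

lemma ex1_projection:
  assumes "hilbert_space_on M ip" "M \<subseteq> V" "f \<in> V"
  shows "\<exists>!g. g \<in> M \<and> (\<forall>h\<in>M. ip (f - g) h = 0)"
proof -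
  interpret M: function_hilbert_space M ip
    by unfold_locales fact
  obtain X g where g: "\<And>n. X n \<in> M" "g \<in> V" "conv X g" "\<And>h. h \<in> M \<Longrightarrow> ip (f - g) h = 0"
    using approximate_projection[OF M.subspace_V assms(2,3)] by blast
  have Cauchy: "\<exists>N. \<forall>m\<ge>N. \<forall>n\<ge>N. M.nsq (X m - X n) < e" if "e > 0" for e
    by (rule conv_imp_Cauchy[OF g(3) _ g(2) that]) (use g(1) assms(2) in blast)
  obtain L where L: "L \<in> M" "conv X L"
    using M.complete[OF g(1) Cauchy] by blast
  have "(\<lambda>n. nsq (X n - L)) \<longlonglongrightarrow> nsq (g - L)"
    by (rule conv_imp_nsq_tendsto[OF conv_diff[OF g(3)]
          diff_mem[OF subsetD[OF assms(2) g(1)] subsetD[OF assms(2) L(1)]]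
          diff_mem[OF g(2) subsetD[OF assms(2) L(1)]]])
  then have "nsq (g - L) = 0"
    using L(2) LIMSEQ_unique unfolding conv_def by blast
  then have "g \<in> M"
    using L(1) nsq_eq_0_iff[OF diff_mem[OF g(2) subsetD[OF assms(2) L(1)]]] by simp
  moreover have "g' = g" if "g' \<in> M" "\<And>h. h \<in> M \<Longrightarrow> ip (f - g') h = 0" for g'
  proof -
    have "g - g' \<in> M"
      using \<open>g \<in> M\<close> that(1) by (rule M.diff_mem)
    then have "ip (f - g') (g - g') - ip (f - g) (g - g') = 0"
      using g(4) that(2) by simp
    moreover have "ip (f - g') (g - g') - ip (f - g) (g - g') = ip ((f - g') - (f - g)) (g - g')"
      by (intro ip_diff_left[symmetric] diff_mem assms(3) g(2) subsetD[OF assms(2)] that(1))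
    ultimately have "ip (g - g') (g - g') = 0"
      by simp
    then show ?thesis
      using M.ip_self_eq_0[OF \<open>g - g' \<in> M\<close>] by simp
  qed
  ultimately show ?thesis
    using g(4) by blast
qed

lemma annihilator_closed:
  assumes "G \<subseteq> V" "\<And>n. X n \<in> V" "L \<in> V" "conv X L" "\<And>n g. g \<in> G \<Longrightarrow> ip (X n) g = 0" "g \<in> G"
  shows "ip L g = 0"
proof -
  have "(\<lambda>n. ip (X n) g) \<longlonglongrightarrow> ip L g"
    by (rule conv_imp_ip_tendsto) (use assms in auto)
  then show ?thesis
    using assms by (simp add: LIMSEQ_const_iff)
qed

end


section \<open>Uniqueness of the space with a given reproducing kernel\<close>

text \<open>The span of the kernel functions lies in both spaces, the two inner products agree on it, and it
  is dense in \<open>V\<close> because a function orthogonal to all kernel functions vanishes everywhere. A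
  sequence in the span that converges to \<open>f\<close> in \<open>V\<close> is therefore Cauchy in \<open>V'\<close>, and since point
  evaluations are continuous on both sides, its limit in \<open>V'\<close> is \<open>f\<close> again.\<close>

lemma RKHS_subset:
  assumes "has_reproducing_kernel V ip K" "has_reproducing_kernel V' ip' K"
  shows "V \<subseteq> V'"
proof
  fix f assume f: "f \<in> V"
  interpret A: function_hilbert_space V ip
    using assms by unfold_locales (simp add: has_reproducing_kernel_def)
  interpret B: function_hilbert_space V' ip'
    using assms by unfold_locales (simp add: has_reproducing_kernel_def)
  let ?k = "\<lambda>w \<eta> z. K z w *v \<eta>"
  let ?G = "{?k w \<eta> |w \<eta>. w \<in> bidisk}"
  have kA: "?k w \<eta> \<in> V" "g \<in> V \<Longrightarrow> ip g (?k w \<eta>) = cip (g w) \<eta>"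
   and kB: "?k w \<eta> \<in> V'" "g \<in> V' \<Longrightarrow> ip' g (?k w \<eta>) = cip (g w) \<eta>" if "w \<in> bidisk" for w \<eta> g
    using assms that by (auto simp: has_reproducing_kernel_def)
  define L where "L = vfun.span ?G"
  have L: "vfun.subspace L"
    by (simp add: L_def)
  have LV: "L \<subseteq> V" "L \<subseteq> V'"
    unfolding L_def by (rule vfun.span_minimal; use kA kB A.subspace_V B.subspace_V in auto)+
  have same: "ip f g = ip' f g" if fg: "f \<in> L" "g \<in> L" for f g
  proof -
    have f: "f \<in> V" "f \<in> V'"
      using fg LV by auto
    have "vfun.subspace {g \<in> V \<inter> V'. ip f g = ip' f g}"
      using f by (auto simp: vfun.subspace_def A.ip_add_right B.ip_add_right A.ip_scale_right
            B.ip_scale_right)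
    moreover have "?G \<subseteq> {g \<in> V \<inter> V'. ip f g = ip' f g}"
      using f kA kB by auto
    ultimately have "L \<subseteq> {g \<in> V \<inter> V'. ip f g = ip' f g}"
      unfolding L_def by (rule vfun.span_minimal[rotated])
    with fg(2) show ?thesis
      by auto
  qed
  obtain X g where X: "\<And>n. X n \<in> L" and g: "g \<in> V" "A.conv X g" "\<And>h. h \<in> L \<Longrightarrow> ip (f - g) h = 0"
    using A.approximate_projection[OF L LV(1) f] by blast
  have off: "h z = 0" if "h \<in> V \<or> h \<in> V'" "z \<notin> bidisk" for h z
    using assms that unfolding has_reproducing_kernel_def by blast
  have "f - g = 0"
  proof
    fix w
    show "(f - g) w = 0 w"
    proof (cases "w \<in> bidisk")
      case True
      have "cip ((f - g) w) \<eta> = 0" for \<eta>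
      proof -
        have "?k w \<eta> \<in> L"
          using True unfolding L_def by (blast intro: vfun.span_base)
        then show ?thesis
          using g(3) kA(2)[OF True A.diff_mem[OF f g(1)]] by metis
      qed
      then have "(f - g) w = 0"
        by (rule cip_nondegenerate)
      then show ?thesis
        by simp
    qed (use off[of "f - g"] A.diff_mem[OF f g(1)] in simp)
  qed
  have XL: "X m - X n \<in> L" for m n
    using X by (simp add: L_def vfun.span_diff)
  have Cauchy: "\<exists>N. \<forall>m\<ge>N. \<forall>n\<ge>N. B.nsq (X m - X n) < e" if "e > 0" for e
  proof -
    have "A.nsq (X m - X n) = B.nsq (X m - X n)" for m n
      using same[OF XL XL] by (simp add: A.nsq_def B.nsq_def)
    then show ?thesis
      using A.conv_imp_Cauchy[OF g(2) subsetD[OF LV(1) X] g(1) that] by simp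
  qed
  obtain h where h: "h \<in> V'" "B.conv X h"
    using B.complete[OF subsetD[OF LV(2) X] Cauchy] by blast
  have "g = h"
  proof
    fix w
    show "g w = h w"
    proof (cases "w \<in> bidisk")
      case True
      have "cip (g w) \<eta> = cip (h w) \<eta>" for \<eta>
      proof (rule LIMSEQ_unique)
        have "(\<lambda>n. ip (X n) (?k w \<eta>)) \<longlonglongrightarrow> ip g (?k w \<eta>)"
          by (rule A.conv_imp_ip_tendsto[OF g(2) subsetD[OF LV(1) X] g(1) kA(1)[OF True]])
        then show "(\<lambda>n. cip (X n w) \<eta>) \<longlonglongrightarrow> cip (g w) \<eta>"
          by (simp only: kA(2)[OF True] subsetD[OF LV(1) X] g(1))
        have "(\<lambda>n. ip' (X n) (?k w \<eta>)) \<longlonglongrightarrow> ip' h (?k w \<eta>)"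
          by (rule B.conv_imp_ip_tendsto[OF h(2) subsetD[OF LV(2) X] h(1) kB(1)[OF True]])
        then show "(\<lambda>n. cip (X n w) \<eta>) \<longlonglongrightarrow> cip (h w) \<eta>"
          by (simp only: kB(2)[OF True] subsetD[OF LV(2) X] h(1))
      qed
      then have "cip (g w + (-1) *s h w) \<eta> = 0" for \<eta>
        by (simp only: cip_add_left cip_scale_left) simp
      then have "g w + (-1) *s h w = 0"
        by (rule cip_nondegenerate)
      then show ?thesis
        by (simp add: vec_eq_iff)
    qed (use off[of g w] off[of h w] g(1) h(1) in simp)
  qed
  with \<open>f - g = 0\<close> h show "f \<in> V'" by simp
qed

lemma RKHS_eq:
  assumes "has_reproducing_kernel V ip K"
  shows "RKHS K = V"
  unfolding RKHS_def using assms RKHS_subset by (intro the_equality) (blast intro: subset_antisym)+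


section \<open>Double power series on the bidisk\<close>

definition bimonomial :: "complex \<times> complex \<Rightarrow> nat \<times> nat \<Rightarrow> complex" where
  "bimonomial z k = fst z ^ fst k * snd z ^ snd k"

text \<open>Absolute convergence of the power series on every smaller closed bidisk. This is weaker than
  \<^const>\<open>square_summable\<close>; it is what Cauchy's estimates give for coefficients not yet known to
  be square summable.\<close>

definition locally_summable :: "(nat \<times> nat \<Rightarrow> 'a::real_normed_vector) \<Rightarrow> bool" where
  "locally_summable a \<longleftrightarrow>
     (\<forall>r. 0 \<le> r \<longrightarrow> r < 1 \<longrightarrow> (\<lambda>k. norm (a k) * r ^ (fst k + snd k)) summable_on UNIV)"

definition truncation :: "nat \<Rightarrow> (nat \<times> nat \<Rightarrow> complex ^ 'd::finite) \<Rightarrow> 'd vfun" where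
  "truncation N a z = (\<Sum>k\<in>{..<N} \<times> {..<N}. bimonomial z k *s a k)"

lemma norm_smult_complex: "norm (c *s (x :: complex ^ 'd::finite)) = norm c * norm x"
  by (simp add: norm_vec_def L2_set_right_distrib norm_mult)

lemma mem_bidisk_iff: "z \<in> bidisk \<longleftrightarrow> norm (fst z) < 1 \<and> norm (snd z) < 1"
  by (cases z) (simp add: bidisk_def)

lemma norm_bimonomial_le:
  assumes "norm (fst z) \<le> r" "norm (snd z) \<le> r"
  shows "norm (bimonomial z k) \<le> r ^ (fst k + snd k)"
  unfolding bimonomial_def norm_mult norm_power power_add
  by (intro mult_mono power_mono assms) (use assms norm_ge_zero order_trans in \<open>blast intro: zero_le_power\<close>)+

lemma summable_on_geometric2:
  assumes "0 \<le> r" "r < (1::real)"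
  shows "(\<lambda>k::nat \<times> nat. r ^ (fst k + snd k)) summable_on UNIV"
proof -
  have has_sum: "((\<lambda>n. r ^ n) has_sum (1 / (1 - r))) UNIV"
    using assms by (intro sums_nonneg_imp_has_sum geometric_sums) auto
  have "(\<lambda>k::nat \<times> nat. r ^ (fst k + snd k)) summable_on (UNIV \<times> UNIV)"
  proof (rule summable_on_SigmaI)
    show "((\<lambda>y. r ^ (fst (x, y) + snd (x, y))) has_sum (r ^ x * (1 / (1 - r)))) UNIV" for x
      using has_sum_cmult_right[OF has_sum, of "r ^ x"] by (simp add: power_add)
    show "(\<lambda>x. r ^ x * (1 / (1 - r))) summable_on UNIV"
      using has_sum by (intro summable_on_cmult_left) (rule has_sum_imp_summable)
  qed (use assms in auto)
  then show ?thesis by simp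
qed

text \<open>Boundedness at a slightly larger radius \<open>\<rho>\<close> yields summability at \<open>r\<close> by comparison with a
  geometric series in \<open>r / \<rho>\<close>.\<close>

lemma locally_summableI:
  assumes "\<And>r. 0 < r \<Longrightarrow> r < 1 \<Longrightarrow> \<exists>C. \<forall>k. norm (a k) * r ^ (fst k + snd k) \<le> C"
  shows "locally_summable a"
  unfolding locally_summable_def
proof (intro allI impI)
  fix r :: real assume r: "0 \<le> r" "r < 1"
  define \<rho> where "\<rho> = (r + 1) / 2"
  have \<rho>: "0 < \<rho>" "\<rho> < 1" "r < \<rho>"
    using r by (auto simp: \<rho>_def)
  obtain C where C: "\<And>k. norm (a k) * \<rho> ^ (fst k + snd k) \<le> C"
    using assms[OF \<rho>(1,2)] by blast
  show "(\<lambda>k. norm (a k) * r ^ (fst k + snd k)) summable_on UNIV"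
  proof (rule summable_on_comparison_test)
    show "(\<lambda>k::nat \<times> nat. C * (r / \<rho>) ^ (fst k + snd k)) summable_on UNIV"
      using r \<rho> by (intro summable_on_cmult_right summable_on_geometric2) auto
    fix k
    have "norm (a k) * r ^ (fst k + snd k) = norm (a k) * \<rho> ^ (fst k + snd k) * (r / \<rho>) ^ (fst k + snd k)"
      using \<rho> by (simp add: power_divide)
    also have "\<dots> \<le> C * (r / \<rho>) ^ (fst k + snd k)"
      using C r \<rho> by (intro mult_right_mono) auto
    finally show "norm (a k) * r ^ (fst k + snd k) \<le> C * (r / \<rho>) ^ (fst k + snd k)" .
  qed (use r in auto)
qed

lemma square_summable_imp_locally_summable:
  assumes "square_summable a"
  shows "locally_summable a"
proof (rule locally_summableI, intro exI allI)
  fix r :: real and k :: "nat \<times> nat"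
  assume r: "0 < r" "r < 1"
  have "sum (\<lambda>k. (norm (a k))\<^sup>2) {k} \<le> (\<Sum>\<^sub>\<infinity>k. (norm (a k))\<^sup>2)"
    using assms unfolding square_summable_def by (intro finite_sum_le_infsum) auto
  then have "norm (a k) \<le> sqrt (\<Sum>\<^sub>\<infinity>k. (norm (a k))\<^sup>2)"
    by (intro real_le_rsqrt) simp
  moreover have "norm (a k) * r ^ (fst k + snd k) \<le> norm (a k) * 1"
    using r by (intro mult_left_mono power_le_one) auto
  ultimately show "norm (a k) * r ^ (fst k + snd k) \<le> sqrt (\<Sum>\<^sub>\<infinity>k. (norm (a k))\<^sup>2)"
    by simp
qed

lemma power_series_eq:
  "power_series a z = (if z \<in> bidisk then (\<Sum>\<^sub>\<infinity>k. bimonomial z k *s a k) else 0)"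
  by (simp add: power_series_def bimonomial_def case_prod_unfold)

lemma power_series_off_bidisk: "z \<notin> bidisk \<Longrightarrow> power_series a z = 0"
  by (simp add: power_series_eq)

lemma abs_summable_power_series:
  assumes "locally_summable a" "z \<in> bidisk"
  shows "(\<lambda>k. norm (bimonomial z k *s a k)) summable_on UNIV"
proof (rule summable_on_comparison_test)
  define r where "r = max (norm (fst z)) (norm (snd z))"
  have r: "0 \<le> r" "r < 1"
    using assms(2) by (auto simp: mem_bidisk_iff r_def le_max_iff_disj)
  then show "(\<lambda>k. norm (a k) * r ^ (fst k + snd k)) summable_on UNIV"
    using assms(1) by (simp add: locally_summable_def)
  show "norm (bimonomial z k *s a k) \<le> norm (a k) * r ^ (fst k + snd k)" for k
    using mult_left_mono[OF norm_bimonomial_le[of z r k], of "norm (a k)"]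
    by (simp add: norm_smult_complex r_def mult.commute)
qed simp

lemma has_sum_power_series:
  assumes "locally_summable a" "z \<in> bidisk"
  shows "((\<lambda>k. bimonomial z k *s a k) has_sum power_series a z) UNIV"
  using has_sum_infsum[OF abs_summable_summable[OF abs_summable_power_series[OF assms]]] assms(2)
  by (simp add: power_series_eq)

lemma power_series_eqI:
  assumes "z \<in> bidisk" "((\<lambda>k. bimonomial z k *s a k) has_sum x) UNIV"
  shows "power_series a z = x"
  using assms by (simp add: power_series_eq infsumI)

text \<open>Uniform convergence of the square partial sums on closed smaller bidisks.\<close>

lemma power_series_truncation:
  assumes a: "locally_summable a" and r: "0 \<le> r" "r < 1" and \<epsilon>: "0 < \<epsilon>"
  obtains N0 where "\<And>N z. N0 \<le> N \<Longrightarrow> norm (fst z) \<le> r \<Longrightarrow> norm (snd z) \<le> r \<Longrightarrow>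
      norm (power_series a z - truncation N a z) \<le> \<epsilon>"
proof -
  define g where "g = (\<lambda>k. norm (a k) * r ^ (fst k + snd k))"
  have g: "g summable_on UNIV" and g0: "g k \<ge> 0" for k
    using a r by (auto simp: locally_summable_def g_def)
  obtain F where F: "finite F" "dist (sum g F) (infsum g UNIV) \<le> \<epsilon>"
    using infsum_finite_approximation[OF g \<epsilon>] by blast
  obtain N0 where N0: "fst ` F \<union> snd ` F \<subseteq> {..<N0}"
    using F(1) finite_nat_iff_bounded by (metis finite_Un finite_imageI)
  have "norm (power_series a z - truncation N a z) \<le> \<epsilon>"
    if N: "N0 \<le> N" and z: "norm (fst z) \<le> r" "norm (snd z) \<le> r" for N z
  proof -
    let ?Q = "{..<N} \<times> {..<N}" and ?t = "\<lambda>k. bimonomial z k *s a k"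
    have zb: "z \<in> bidisk"
      using z r by (auto simp: mem_bidisk_iff)
    have "F \<subseteq> ?Q"
      using N0 N by (force simp: subset_iff mem_Times_iff)
    have abs: "(\<lambda>k. norm (?t k)) summable_on A" for A
      using abs_summable_power_series[OF a zb] by (rule summable_on_subset_banach) simp
    have "(?t has_sum power_series a z - sum ?t ?Q) (UNIV - ?Q)"
      by (intro has_sum_Diff has_sum_power_series[OF a zb] has_sum_finite) auto
    then have "power_series a z - truncation N a z = infsum ?t (- ?Q)"
      by (simp add: truncation_def infsumI Compl_eq_Diff_UNIV)
    also have "norm \<dots> \<le> (\<Sum>\<^sub>\<infinity>k\<in>- ?Q. norm (?t k))"
      using abs by (rule norm_infsum_bound)
    also have "\<dots> \<le> infsum g (- ?Q)"
    proof (rule infsum_mono[OF abs])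
      show "g summable_on - ?Q"
        using g by (rule summable_on_subset_banach) simp
      show "norm (?t k) \<le> g k" for k
        using mult_left_mono[OF norm_bimonomial_le[OF z, of k], of "norm (a k)"]
        by (simp add: norm_smult_complex g_def mult.commute)
    qed
    also have "\<dots> = infsum g UNIV - sum g ?Q"
      using has_sum_Diff[OF has_sum_infsum[OF g] has_sum_finite[of ?Q g]]
      by (simp add: infsumI Compl_eq_Diff_UNIV)
    also have "\<dots> \<le> infsum g UNIV - sum g F"
      using \<open>F \<subseteq> ?Q\<close> g0 by (simp add: sum_mono2)
    also have "\<dots> \<le> \<epsilon>"
      using F(2) by (simp add: dist_real_def)
    finally show ?thesis .
  qed
  then show ?thesis by (rule that)
qed


section \<open>Averages over roots of unity\<close>

text \<open>The quadratic mean over a torus is replaced by the mean over the \<open>N\<^sup>2\<close> points whose coordinates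
  are \<open>r\<close> times an \<open>N\<close>th root of unity. For polynomials of degree below \<open>N\<close> in each variable
  Parseval's identity holds exactly for these finite means, so no integrals are involved.\<close>

definition unity_root :: "nat \<Rightarrow> complex" where
  "unity_root N = cis (2 * pi / real N)"

lemma unity_root_power: "unity_root N ^ j = cis (2 * pi * real j / real N)"
  by (simp add: unity_root_def Complex.DeMoivre mult_ac)

lemma unity_root_orthogonality:
  assumes "j < N" "k < N"
  shows "(\<Sum>a<N. unity_root N ^ (a * j) * cnj (unity_root N ^ (a * k))) = (if j = k then of_nat N else 0)"
proof -
  have N: "N > 0"
    using assms by simp
  define q where "q = unity_root N ^ j * cnj (unity_root N ^ k)"
  have unit: "x * cnj x = 1" if "norm x = 1" for x :: complex
    using that by (simp add: complex_norm_square[symmetric])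
  have norm_root: "norm (unity_root N ^ l) = 1" for l
    by (simp add: unity_root_power)
  have "(\<Sum>a<N. unity_root N ^ (a * j) * cnj (unity_root N ^ (a * k))) = (\<Sum>a<N. q ^ a)"
    by (simp add: q_def power_mult_distrib mult.commute[of _ j] mult.commute[of _ k] power_mult)
  also have "\<dots> = (if j = k then of_nat N else 0)"
  proof (cases "j = k")
    case True
    then have "q = 1"
      using unit[OF norm_root] by (simp add: q_def)
    with True show ?thesis by simp
  next
    case False
    have "q \<noteq> 1"
    proof
      assume "q = 1"
      have "unity_root N ^ j * (unity_root N ^ k * cnj (unity_root N ^ k)) = q * unity_root N ^ k"
        by (simp add: q_def)
      then have "unity_root N ^ j = unity_root N ^ k"
        unfolding unit[OF norm_root] \<open>q = 1\<close> by simp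
      then show False
        using False bij_betw_imp_inj_on[OF Complex.bij_betw_roots_unity[OF N]] assms
        by (auto simp: unity_root_power inj_on_def)
    qed
    moreover have "unity_root N ^ (N * l) = 1" for l
      using N by (simp add: unity_root_def Complex.DeMoivre power_mult)
    then have "q ^ N = 1"
      by (simp add: q_def power_mult_distrib mult.commute[of _ N] flip: power_mult complex_cnj_power)
    ultimately show ?thesis
      using False by (simp add: geometric_sum)
  qed
  finally show ?thesis .
qed

lemma discrete_Parseval_complex:
  fixes x :: "nat \<Rightarrow> complex"
  shows "(\<Sum>a<N. (norm (\<Sum>j<N. unity_root N ^ (a * j) * x j))\<^sup>2) = real N * (\<Sum>j<N. (norm (x j))\<^sup>2)"
proof -
  have "complex_of_real (\<Sum>a<N. (norm (\<Sum>j<N. unity_root N ^ (a * j) * x j))\<^sup>2)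
      = (\<Sum>a<N. (\<Sum>j<N. unity_root N ^ (a * j) * x j) * cnj (\<Sum>k<N. unity_root N ^ (a * k) * x k))"
    by (simp only: of_real_sum complex_norm_square)
  also have "\<dots> = (\<Sum>a<N. \<Sum>j<N. \<Sum>k<N. (x j * cnj (x k)) * (unity_root N ^ (a * j) * cnj (unity_root N ^ (a * k))))"
    by (simp only: sum_product cnj_sum complex_cnj_mult mult_ac)
  also have "\<dots> = (\<Sum>j<N. \<Sum>k<N. \<Sum>a<N. (x j * cnj (x k)) * (unity_root N ^ (a * j) * cnj (unity_root N ^ (a * k))))"
    by (subst sum.swap) (intro sum.cong refl sum.swap)
  also have "\<dots> = (\<Sum>j<N. \<Sum>k<N. (x j * cnj (x k)) * (if j = k then of_nat N else 0))"
    by (intro sum.cong refl) (simp only: unity_root_orthogonality lessThan_iff flip: sum_distrib_left)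
  also have "\<dots> = (\<Sum>j<N. (x j * cnj (x j)) * of_nat N)"
    by (intro sum.cong refl) (simp add: if_distrib[of "\<lambda>t. _ * t"] sum.delta' cong: if_cong)
  also have "\<dots> = of_real (real N * (\<Sum>j<N. (norm (x j))\<^sup>2))"
    by (simp add: sum_distrib_left mult.commute flip: complex_norm_square)
  finally show ?thesis
    by (simp only: of_real_eq_iff)
qed

lemma discrete_Parseval:
  fixes x :: "nat \<Rightarrow> complex ^ 'd::finite"
  shows "(\<Sum>a<N. (norm (\<Sum>j<N. unity_root N ^ (a * j) *s x j))\<^sup>2) = real N * (\<Sum>j<N. (norm (x j))\<^sup>2)"
proof -
  have "(\<Sum>a<N. (norm (\<Sum>j<N. unity_root N ^ (a * j) *s x j))\<^sup>2)
      = (\<Sum>i\<in>UNIV. \<Sum>a<N. (norm (\<Sum>j<N. unity_root N ^ (a * j) * x j $ i))\<^sup>2)"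
    by (subst sum.swap) (simp add: norm_squared_vec sum_component)
  also have "\<dots> = (\<Sum>i\<in>UNIV. real N * (\<Sum>j<N. (norm (x j $ i))\<^sup>2))"
    by (simp only: discrete_Parseval_complex)
  also have "\<dots> = real N * (\<Sum>j<N. \<Sum>i\<in>UNIV. (norm (x j $ i))\<^sup>2)"
    by (subst sum.swap) (simp add: sum_distrib_left)
  finally show ?thesis
    by (simp add: norm_squared_vec)
qed

definition torus_point :: "nat \<Rightarrow> real \<Rightarrow> nat \<times> nat \<Rightarrow> complex \<times> complex" where
  "torus_point N r p = (of_real r * unity_root N ^ fst p, of_real r * unity_root N ^ snd p)"

lemma discrete_Parseval2:
  fixes c :: "nat \<times> nat \<Rightarrow> complex ^ 'd::finite"
  assumes "0 \<le> r"
  shows "L2_set (\<lambda>p. norm (truncation N c (torus_point N r p))) ({..<N} \<times> {..<N})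
    = real N * L2_set (\<lambda>k. norm (c k) * r ^ (fst k + snd k)) ({..<N} \<times> {..<N})"
proof -
  define e where "e j k = complex_of_real (r ^ (j + k)) *s c (j, k)" for j k
  have norm_e: "norm (e j k) = norm (c (j, k)) * r ^ (j + k)" for j k
    using assms by (simp add: e_def norm_smult_complex norm_power power_add norm_mult mult.commute)
  have trunc: "truncation N c (torus_point N r (a, b))
      = (\<Sum>j<N. unity_root N ^ (a * j) *s (\<Sum>k<N. unity_root N ^ (b * k) *s e j k))" for a b
  proof -
    have "truncation N c (torus_point N r (a, b)) =
        (\<Sum>j<N. \<Sum>k<N. bimonomial (torus_point N r (a, b)) (j, k) *s c (j, k))"
      by (simp add: truncation_def sum.cartesian_product case_prod_unfold)
    also have "\<dots> = (\<Sum>j<N. \<Sum>k<N. unity_root N ^ (a * j) *s (unity_root N ^ (b * k) *s e j k))"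
      by (intro sum.cong refl)
        (simp add: bimonomial_def torus_point_def e_def vector_smult_assoc power_mult_distrib
          power_add mult_ac flip: power_mult)
    also have "\<dots> = (\<Sum>j<N. unity_root N ^ (a * j) *s (\<Sum>k<N. unity_root N ^ (b * k) *s e j k))"
      by (simp add: vec.scale_sum_right)
    finally show ?thesis .
  qed
  have "(\<Sum>p\<in>{..<N} \<times> {..<N}. (norm (truncation N c (torus_point N r p)))\<^sup>2)
      = (\<Sum>a<N. \<Sum>b<N. (norm (truncation N c (torus_point N r (a, b))))\<^sup>2)"
    by (simp add: sum.cartesian_product case_prod_unfold)
  also have "\<dots> = (\<Sum>b<N. \<Sum>a<N. (norm (truncation N c (torus_point N r (a, b))))\<^sup>2)"
    by (rule sum.swap)
  also have "\<dots> = (\<Sum>b<N. real N * (\<Sum>j<N. (norm (\<Sum>k<N. unity_root N ^ (b * k) *s e j k))\<^sup>2))"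
    by (simp only: trunc discrete_Parseval)
  also have "\<dots> = real N * (\<Sum>j<N. \<Sum>b<N. (norm (\<Sum>k<N. unity_root N ^ (b * k) *s e j k))\<^sup>2)"
    by (subst sum.swap) (simp add: sum_distrib_left)
  also have "\<dots> = real N * (\<Sum>j<N. real N * (\<Sum>k<N. (norm (e j k))\<^sup>2))"
    by (simp only: discrete_Parseval)
  also have "\<dots> = (real N)\<^sup>2 * (\<Sum>j<N. \<Sum>k<N. (norm (e j k))\<^sup>2)"
    by (simp add: power2_eq_square mult.assoc flip: sum_distrib_left)
  also have "(\<Sum>j<N. \<Sum>k<N. (norm (e j k))\<^sup>2)
      = (\<Sum>p\<in>{..<N} \<times> {..<N}. (norm (c p) * r ^ (fst p + snd p))\<^sup>2)"
    by (simp add: norm_e sum.cartesian_product case_prod_unfold)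
  finally show ?thesis
    by (simp add: L2_set_def real_sqrt_mult)
qed

text \<open>Truncate both series at degree \<open>N\<close>. On a torus of radius \<open>r < 1\<close> the truncations differ from the
  functions by at most \<open>\<epsilon>\<close>, so the pointwise inequality survives up to an error \<open>(C + 1) \<epsilon>\<close>; taking
  discrete quadratic means and applying Parseval's identity turns it into an inequality between
  coefficients. Then let \<open>\<epsilon>\<close> tend to \<open>0\<close> and \<open>r\<close> to \<open>1\<close>.\<close>

theorem coefficients_dominated:
  fixes c a :: "nat \<times> nat \<Rightarrow> complex ^ 'd::finite"
  assumes c: "locally_summable c" and a: "square_summable a" and C: "0 \<le> C"
    and le: "\<And>z. z \<in> bidisk \<Longrightarrow> norm (power_series c z) \<le> C * norm (power_series a z)"
    and S: "finite S"
  shows "L2_set (\<lambda>k. norm (c k)) S \<le> C * sqrt (\<Sum>\<^sub>\<infinity>k. (norm (a k))\<^sup>2)"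
proof -
  define A where "A = sqrt (\<Sum>\<^sub>\<infinity>k. (norm (a k))\<^sup>2)"
  have a': "locally_summable a"
    using a by (rule square_summable_imp_locally_summable)
  have approx: "L2_set (\<lambda>k. norm (c k) * r ^ (fst k + snd k)) S \<le> C * A + (C + 1) * \<epsilon>"
    if r: "0 \<le> r" "r < 1" and \<epsilon>: "0 < \<epsilon>" for r \<epsilon>
  proof -
    obtain N1 where N1: "\<And>N z. N1 \<le> N \<Longrightarrow> norm (fst z) \<le> r \<Longrightarrow> norm (snd z) \<le> r \<Longrightarrow>
        norm (power_series c z - truncation N c z) \<le> \<epsilon>"
      using power_series_truncation[OF c r \<epsilon>] by blast
    obtain N2 where N2: "\<And>N z. N2 \<le> N \<Longrightarrow> norm (fst z) \<le> r \<Longrightarrow> norm (snd z) \<le> r \<Longrightarrow>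
        norm (power_series a z - truncation N a z) \<le> \<epsilon>"
      using power_series_truncation[OF a' r \<epsilon>] by blast
    obtain N3 where N3: "fst ` S \<union> snd ` S \<subseteq> {..<N3}"
      using S finite_nat_iff_bounded by (metis finite_Un finite_imageI)
    define N where "N = Max {1, N1, N2, N3}"
    have N: "1 \<le> N" "N1 \<le> N" "N2 \<le> N" "N3 \<le> N"
      by (auto simp: N_def)
    let ?Q = "{..<N} \<times> {..<N}"
    define p where "p = torus_point N r"
    have "S \<subseteq> ?Q"
      using N3 N(4) by (force simp: subset_iff mem_Times_iff)
    have p: "norm (fst (p q)) \<le> r" "norm (snd (p q)) \<le> r" for q
      using r by (simp_all add: p_def torus_point_def norm_mult unity_root_power)
    have pointwise: "norm (truncation N c (p q)) \<le> C * norm (truncation N a (p q)) + (C + 1) * \<epsilon>" for q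
    proof -
      have "norm (truncation N c (p q)) \<le> norm (power_series c (p q)) + \<epsilon>"
        using N1[OF N(2) p, of q] norm_triangle_ineq3[of "power_series c (p q)" "truncation N c (p q)"]
        by linarith
      also have "norm (power_series c (p q)) \<le> C * norm (power_series a (p q))"
        using p[of q] r by (intro le) (auto simp: mem_bidisk_iff)
      also have "C * norm (power_series a (p q)) \<le> C * (norm (truncation N a (p q)) + \<epsilon>)"
        using N2[OF N(3) p, of q] norm_triangle_ineq3[of "power_series a (p q)" "truncation N a (p q)"] C
        by (intro mult_left_mono) linarith+
      finally show ?thesis
        using C by (simp add: algebra_simps)
    qed
    have "real N * L2_set (\<lambda>k. norm (c k) * r ^ (fst k + snd k)) ?Q
        = L2_set (\<lambda>q. norm (truncation N c (p q))) ?Q"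
      using r by (simp add: discrete_Parseval2 p_def)
    also have "\<dots> \<le> L2_set (\<lambda>q. C * norm (truncation N a (p q)) + (C + 1) * \<epsilon>) ?Q"
      by (intro L2_set_mono pointwise) auto
    also have "\<dots> \<le> L2_set (\<lambda>q. C * norm (truncation N a (p q))) ?Q + L2_set (\<lambda>q. (C + 1) * \<epsilon>) ?Q"
      by (rule L2_set_triangle_ineq)
    also have "L2_set (\<lambda>q. (C + 1) * \<epsilon>) ?Q = real N * ((C + 1) * \<epsilon>)"
      using C \<epsilon> by (simp add: L2_set_constant)
    also have "L2_set (\<lambda>q. C * norm (truncation N a (p q))) ?Q
        = real N * (C * L2_set (\<lambda>k. norm (a k) * r ^ (fst k + snd k)) ?Q)"
      using C r by (simp add: discrete_Parseval2 p_def flip: L2_set_right_distrib)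
    also have "\<dots> + real N * ((C + 1) * \<epsilon>)
        = real N * (C * L2_set (\<lambda>k. norm (a k) * r ^ (fst k + snd k)) ?Q + (C + 1) * \<epsilon>)"
      by (simp add: algebra_simps)
    finally have "L2_set (\<lambda>k. norm (c k) * r ^ (fst k + snd k)) ?Q
        \<le> C * L2_set (\<lambda>k. norm (a k) * r ^ (fst k + snd k)) ?Q + (C + 1) * \<epsilon>"
      using N(1) by simp
    moreover have "L2_set (\<lambda>k. norm (a k) * r ^ (fst k + snd k)) ?Q \<le> L2_set (\<lambda>k. norm (a k)) ?Q"
      using r by (intro L2_set_mono mult_left_le power_le_one) auto
    moreover have "L2_set (\<lambda>k. norm (a k)) ?Q \<le> A"
      using a unfolding A_def L2_set_def square_summable_def
      by (intro real_sqrt_le_mono finite_sum_le_infsum) auto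
    moreover have "L2_set (\<lambda>k. norm (c k) * r ^ (fst k + snd k)) S
        \<le> L2_set (\<lambda>k. norm (c k) * r ^ (fst k + snd k)) ?Q"
      unfolding L2_set_def using \<open>S \<subseteq> ?Q\<close> by (intro real_sqrt_le_mono sum_mono2) auto
    ultimately show ?thesis
      using C mult_left_mono[of _ A C] by (smt (verit, best))
  qed
  have "L2_set (\<lambda>k. norm (c k) * r ^ (fst k + snd k)) S \<le> C * A" if r: "0 \<le> r" "r < 1" for r
  proof (rule field_le_epsilon)
    fix e :: real assume "e > 0"
    then show "L2_set (\<lambda>k. norm (c k) * r ^ (fst k + snd k)) S \<le> C * A + e"
      using approx[OF r, of "e / (C + 1)"] C by simp
  qed
  then have "\<forall>\<^sub>F r in at_left 1. L2_set (\<lambda>k. norm (c k) * r ^ (fst k + snd k)) S \<le> C * A"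
    by (intro eventually_at_leftI[of 0]) auto
  moreover have "((\<lambda>r. L2_set (\<lambda>k. norm (c k) * r ^ (fst k + snd k)) S) \<longlongrightarrow>
      L2_set (\<lambda>k. norm (c k) * 1 ^ (fst k + snd k)) S) (at_left (1::real))"
    unfolding L2_set_def by (intro tendsto_intros)
  ultimately show ?thesis
    using tendsto_upperbound[of _ _ "at_left (1::real)"] by (fastforce simp: A_def)
qed

corollary square_summable_if_dominated:
  fixes c a :: "nat \<times> nat \<Rightarrow> complex ^ 'd::finite"
  assumes c: "locally_summable c" and a: "square_summable a" and C: "0 \<le> C"
    and le: "\<And>z. z \<in> bidisk \<Longrightarrow> norm (power_series c z) \<le> C * norm (power_series a z)"
  shows "square_summable c"
  unfolding square_summable_def
proof (rule nonneg_bdd_above_summable_on)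
  have "sum (\<lambda>k. (norm (c k))\<^sup>2) F \<le> (C * sqrt (\<Sum>\<^sub>\<infinity>k. (norm (a k))\<^sup>2))\<^sup>2" if "finite F" for F
    using power_mono[OF coefficients_dominated[OF assms that], of 2]
    by (simp add: L2_set_def sum_nonneg real_sqrt_pow2)
  then show "bdd_above (sum (\<lambda>k. (norm (c k))\<^sup>2) ` {F. F \<subseteq> UNIV \<and> finite F})"
    by (intro bdd_aboveI) auto
qed simp

text \<open>The zero function is dominated by the zero power series.\<close>

corollary power_series_eq_0_imp:
  fixes c :: "nat \<times> nat \<Rightarrow> complex ^ 'd::finite"
  assumes c: "locally_summable c" and zero: "\<And>z. z \<in> bidisk \<Longrightarrow> power_series c z = 0"
  shows "c k = 0"
proof -
  have "square_summable (\<lambda>k. 0 :: complex ^ 'd)"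
    by (simp add: square_summable_def)
  then have "L2_set (\<lambda>k. norm (c k)) {k} \<le> 0 * sqrt (\<Sum>\<^sub>\<infinity>k::nat\<times>nat. (norm (0 :: complex ^ 'd))\<^sup>2)"
    using zero by (intro coefficients_dominated[OF c]) auto
  then show ?thesis
    by (simp add: L2_set_def)
qed


section \<open>Power series expansion of separately holomorphic functions\<close>

definition separately_holomorphic :: "(complex \<times> complex \<Rightarrow> complex) \<Rightarrow> bool" where
  "separately_holomorphic F \<longleftrightarrow>
     (\<forall>w\<in>ball 0 1. (\<lambda>u. F (u, w)) holomorphic_on ball 0 1) \<and>
     (\<forall>u\<in>ball 0 1. (\<lambda>w. F (u, w)) holomorphic_on ball 0 1)"

definition bounded_on_bidisks :: "(complex \<times> complex \<Rightarrow> 'a::real_normed_vector) \<Rightarrow> bool" where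
  "bounded_on_bidisks F \<longleftrightarrow>
     (\<forall>r. 0 < r \<longrightarrow> r < 1 \<longrightarrow> (\<exists>C. \<forall>z. norm (fst z) \<le> r \<longrightarrow> norm (snd z) \<le> r \<longrightarrow> norm (F z) \<le> C))"

lemma Cauchy_coefficient_bound:
  assumes "f holomorphic_on ball 0 1" "0 < \<rho>" "\<rho> < 1" "\<And>u. norm u = \<rho> \<Longrightarrow> norm (f u) \<le> C"
  shows "norm ((deriv ^^ j) f 0 / fact j) \<le> C / \<rho> ^ j"
proof -
  have "norm ((deriv ^^ j) f 0) \<le> fact j * C / \<rho> ^ j"
  proof (rule Cauchy_inequality)
    show "f holomorphic_on ball 0 \<rho>"
      using assms(1,3) by (rule_tac holomorphic_on_subset) auto
    show "continuous_on (cball 0 \<rho>) f"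
      using assms(1,3) by (intro holomorphic_on_imp_continuous_on) (rule holomorphic_on_subset, auto)
  qed (use assms in auto)
  then show ?thesis
    by (simp add: norm_divide field_simps)
qed

text \<open>Let \<open>\<phi> j\<close> be the \<open>j\<close>th Taylor coefficient of \<open>F\<close> in the first variable, a function of the second
  one. By induction it is a locally uniform limit of holomorphic functions: subtract from
  \<open>F (x, w)\<close> the terms of order below \<open>j\<close>, divide by \<open>x ^ j\<close>, and let \<open>x\<close> run through a null
  sequence. Cauchy's estimates bound the remainder by a multiple of \<open>norm x\<close>, locally uniformly in
  \<open>w\<close>.\<close>

lemma holomorphic_coefficient:
  assumes hol: "separately_holomorphic F" and bnd: "bounded_on_bidisks F"
  shows "(\<lambda>w. (deriv ^^ j) (\<lambda>u. F (u, w)) 0 / fact j) holomorphic_on ball 0 1"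
proof (induction j rule: less_induct)
  case (less j)
  define \<phi> where "\<phi> l w = (deriv ^^ l) (\<lambda>u. F (u, w)) 0 / fact l" for l w
  \<comment> \<open>The shift by 2 keeps the sequence in the open disk from the start.\<close>
  define x where "x n = complex_of_real (1 / (real n + 2))" for n
  define G where "G n w = (F (x n, w) - (\<Sum>l<j. \<phi> l w * x n ^ l)) / x n ^ j" for n w
  have x_norm: "norm (x n) = 1 / real (n + 2)" for n
    unfolding x_def norm_of_real by simp
  then have x: "x n \<noteq> 0" "norm (x n) < 1" for n
    using norm_eq_zero[of "x n"] by (auto simp del: norm_eq_zero)
  have "\<phi> j holomorphic_on ball 0 1"
  proof (rule holomorphic_uniform_sequence[of _ G])
    show "G n holomorphic_on ball 0 1" for n
    proof -
      have "(\<lambda>w. F (x n, w)) holomorphic_on ball 0 1"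
        using hol x(2) by (auto simp: separately_holomorphic_def)
      moreover have "\<phi> l holomorphic_on ball 0 1" if "l < j" for l
        using less[OF that] by (simp add: \<phi>_def[abs_def])
      ultimately show ?thesis
        unfolding G_def using x(1) by (intro holomorphic_intros) auto
    qed
    fix w0 :: complex assume w0: "w0 \<in> ball 0 1"
    define d where "d = (1 - norm w0) / 2"
    define \<rho> where "\<rho> = (1 + norm w0) / 2"
    have d: "0 < d" and \<rho>: "0 < \<rho>" "\<rho> < 1"
      using w0 norm_ge_zero[of w0] unfolding d_def \<rho>_def by (auto simp del: norm_ge_zero)
    have near: "norm w \<le> \<rho>" if "w \<in> cball w0 d" for w
    proof -
      have "norm w \<le> norm w0 + norm (w - w0)"
        using norm_triangle_ineq[of w0 "w - w0"] by simp
      with that show ?thesis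
        by (simp add: dist_norm norm_minus_commute d_def \<rho>_def field_simps)
    qed
    obtain C where "\<forall>z. norm (fst z) \<le> \<rho> \<longrightarrow> norm (snd z) \<le> \<rho> \<longrightarrow> norm (F z) \<le> C"
      using bnd \<rho> unfolding bounded_on_bidisks_def by blast
    then have C: "norm (F (u, w)) \<le> C" if "norm u \<le> \<rho>" "norm w \<le> \<rho>" for u w
      using that by simp
    have "0 \<le> C"
      using order_trans[OF norm_ge_zero C[of 0 0]] \<rho> by simp
    \<comment> \<open>For \<open>norm (x n) \<le> \<rho> / 2\<close> the remainder is dominated by a geometric series of ratio at most 1/2.\<close>
    have err: "norm (G n w - \<phi> j w) \<le> 2 * C / \<rho> ^ Suc j * norm (x n)"
      if n: "norm (x n) \<le> \<rho> / 2" and w: "norm w \<le> \<rho>" for n w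
    proof -
      have hol_w: "(\<lambda>u. F (u, w)) holomorphic_on ball 0 1"
        using hol w \<rho> by (auto simp: separately_holomorphic_def)
      define t where "t l = \<phi> l w * x n ^ l" for l
      define q where "q = norm (x n) / \<rho>"
      have q: "0 \<le> q" "q \<le> 1 / 2"
        using n \<rho> by (simp_all add: q_def field_simps)
      have "t sums F (x n, w)"
        using holomorphic_power_series[OF hol_w, of "x n"] x(2) by (simp add: t_def[abs_def] \<phi>_def)
      then have "(\<lambda>l. t (l + Suc j)) sums (F (x n, w) - (\<Sum>l<Suc j. t l))"
        by (rule sums_split_initial_segment)
      moreover have "(\<lambda>l. C * q ^ Suc j * q ^ l) sums (C * q ^ Suc j * (1 / (1 - q)))"
        using q by (intro sums_mult geometric_sums) auto
      moreover have "norm (t (l + Suc j)) \<le> C * q ^ Suc j * q ^ l" for l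
      proof -
        have "norm (\<phi> (l + Suc j) w) \<le> C / \<rho> ^ (l + Suc j)"
          unfolding \<phi>_def by (rule Cauchy_coefficient_bound[OF hol_w \<rho>]) (use C w in auto)
        then have "norm (\<phi> (l + Suc j) w) * norm (x n) ^ (l + Suc j)
            \<le> C / \<rho> ^ (l + Suc j) * norm (x n) ^ (l + Suc j)"
          by (rule mult_right_mono) simp
        then show ?thesis
          by (simp only: t_def norm_mult norm_power q_def power_divide power_add[of _ l] mult_ac
              times_divide_eq_left times_divide_eq_right divide_divide_eq_left)
      qed
      ultimately have "norm (F (x n, w) - (\<Sum>l<Suc j. t l)) \<le> C * q ^ Suc j * (1 / (1 - q))"
        by (rule norm_sums_le)
      also have "\<dots> \<le> C * q ^ Suc j * 2"
        using q \<open>0 \<le> C\<close> by (intro mult_left_mono) (auto simp: field_simps)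
      also have "F (x n, w) - (\<Sum>l<Suc j. t l) = (G n w - \<phi> j w) * x n ^ j"
        using x(1) by (simp add: G_def t_def field_simps)
      finally have "norm (G n w - \<phi> j w) * norm (x n) ^ j \<le>
          2 * C / \<rho> ^ Suc j * norm (x n) * norm (x n) ^ j"
        by (simp add: norm_mult norm_power q_def power_divide mult_ac)
      then show ?thesis
        using x(1)[of n] by (simp only: mult_le_cancel_right) auto
    qed
    have "uniform_limit (cball w0 d) G (\<phi> j) sequentially"
    proof (rule uniform_limitI)
      fix e :: real assume "e > 0"
      have x0: "(\<lambda>n. norm (x n)) \<longlonglongrightarrow> 0"
        using LIMSEQ_ignore_initial_segment[OF lim_1_over_n, of 2] by (simp add: x_norm)
      then have "(\<lambda>n. 2 * C / \<rho> ^ Suc j * norm (x n)) \<longlonglongrightarrow> 2 * C / \<rho> ^ Suc j * 0"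
        by (intro tendsto_mult_left)
      then have "\<forall>\<^sub>F n in sequentially. 2 * C / \<rho> ^ Suc j * norm (x n) < e"
        using \<open>e > 0\<close> by (intro order_tendstoD) auto
      moreover have "\<forall>\<^sub>F n in sequentially. norm (x n) < \<rho> / 2"
        using x0 \<rho> by (intro order_tendstoD) auto
      ultimately show "\<forall>\<^sub>F n in sequentially. \<forall>w\<in>cball w0 d. dist (G n w) (\<phi> j w) < e"
      proof eventually_elim
        case (elim n)
        show ?case
        proof
          fix w assume "w \<in> cball w0 d"
          then show "dist (G n w) (\<phi> j w) < e"
            using err[of n w] near[of w] elim by (simp add: dist_norm)
        qed
      qed
    qed
    moreover have "cball w0 d \<subseteq> ball 0 1"
      using near \<rho> by fastforce
    ultimately show "\<exists>d>0. cball w0 d \<subseteq> ball 0 1 \<and> uniform_limit (cball w0 d) G (\<phi> j) sequentially"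
      using d by blast
  qed simp
  then show ?case
    by (simp add: \<phi>_def[abs_def])
qed

text \<open>Expand in the first variable, then expand the coefficients in the second one. Cauchy's estimates,
  applied twice, bound the double coefficients; the resulting absolute convergence lets the iterated
  sum be read as an unordered one.\<close>

theorem double_power_series_expansion:
  assumes hol: "separately_holomorphic F" and bnd: "bounded_on_bidisks F"
  obtains c :: "nat \<times> nat \<Rightarrow> complex" where
    "\<And>r. 0 < r \<Longrightarrow> r < 1 \<Longrightarrow> \<exists>C. \<forall>k. norm (c k) * r ^ (fst k + snd k) \<le> C"
    "\<And>z. z \<in> bidisk \<Longrightarrow> ((\<lambda>k. bimonomial z k * c k) has_sum F z) UNIV"
proof -
  define \<phi> where "\<phi> j w = (deriv ^^ j) (\<lambda>u. F (u, w)) 0 / fact j" for j w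
  define c where "c k = (deriv ^^ snd k) (\<phi> (fst k)) 0 / fact (snd k)" for k
  have hol_\<phi>: "\<phi> j holomorphic_on ball 0 1" for j
    using holomorphic_coefficient[OF hol bnd] by (simp add: \<phi>_def[abs_def])
  have bound: "\<exists>C. \<forall>k. norm (c k) * r ^ (fst k + snd k) \<le> C" if r: "0 < r" "r < 1" for r
  proof -
    obtain C where "\<forall>z. norm (fst z) \<le> r \<longrightarrow> norm (snd z) \<le> r \<longrightarrow> norm (F z) \<le> C"
      using bnd r unfolding bounded_on_bidisks_def by blast
    then have C: "norm (F (u, w)) \<le> C" if "norm u \<le> r" "norm w \<le> r" for u w
      using that by simp
    have "norm (c k) * r ^ (fst k + snd k) \<le> C" for k
    proof -
      have "norm (\<phi> (fst k) w) \<le> C / r ^ fst k" if "norm w = r" for w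
        unfolding \<phi>_def using hol r that C
        by (intro Cauchy_coefficient_bound[OF _ r]) (auto simp: separately_holomorphic_def)
      then have "norm (c k) \<le> C / r ^ fst k / r ^ snd k"
        unfolding c_def by (intro Cauchy_coefficient_bound[OF hol_\<phi> r])
      then show ?thesis
        using r by (simp add: field_simps power_add)
    qed
    then show ?thesis by blast
  qed
  have "((\<lambda>k. bimonomial z k * c k) has_sum F z) UNIV" if z: "z \<in> bidisk" for z
  proof -
    let ?t = "\<lambda>k. bimonomial z k * c k"
    obtain u w where zuw: "z = (u, w)" and u: "norm u < 1" and w: "norm w < 1"
      using z by (cases z) (auto simp: mem_bidisk_iff)
    define r where "r = max (norm u) (norm w)"
    have r: "0 \<le> r" "r < 1"
      using u w by (auto simp: r_def le_max_iff_disj)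
    have "locally_summable c"
      using bound by (rule locally_summableI)
    then have "(\<lambda>k. norm (c k) * r ^ (fst k + snd k)) summable_on UNIV"
      using r by (simp add: locally_summable_def)
    moreover have "norm (?t k) \<le> norm (c k) * r ^ (fst k + snd k)" for k
      using mult_left_mono[OF norm_bimonomial_le[of z r k], of "norm (c k)"]
      by (simp add: norm_mult zuw r_def mult.commute)
    ultimately have "(\<lambda>k. norm (?t k)) summable_on UNIV"
      by (intro summable_on_comparison_test[of _ UNIV "\<lambda>k. norm (?t k)"]) auto
    then have summable: "?t summable_on UNIV \<times> UNIV"
      using abs_summable_summable by (simp add: UNIV_Times_UNIV)
    have inner: "((\<lambda>k. ?t (j, k)) has_sum (\<phi> j w * u ^ j)) UNIV" for j
    proof -
      have "(\<lambda>k. ?t (j, k)) summable_on UNIV"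
        using summable_on_SigmaD1[of "\<lambda>j k. ?t (j, k)" UNIV "\<lambda>_. UNIV" j] summable
        by (simp add: case_prod_unfold)
      then have has: "((\<lambda>k. ?t (j, k)) has_sum infsum (\<lambda>k. ?t (j, k)) UNIV) UNIV"
        by (rule has_sum_infsum)
      have "(\<lambda>k. c (j, k) * w ^ k) sums \<phi> j w"
        using holomorphic_power_series[OF hol_\<phi>, of w j] w by (simp add: c_def)
      from sums_mult[OF this, of "u ^ j"] have "(\<lambda>k. ?t (j, k)) sums (\<phi> j w * u ^ j)"
        by (simp add: bimonomial_def zuw mult_ac)
      from sums_unique2[OF has_sum_imp_sums[OF has] this] has show ?thesis
        by simp
    qed
    have total: "(?t has_sum infsum ?t (UNIV \<times> UNIV)) (UNIV \<times> UNIV)"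
      using summable by (rule has_sum_infsum)
    have "((\<lambda>j. \<phi> j w * u ^ j) has_sum infsum ?t (UNIV \<times> UNIV)) UNIV"
      using has_sum_SigmaD[OF total inner] .
    then have "(\<lambda>j. \<phi> j w * u ^ j) sums infsum ?t (UNIV \<times> UNIV)"
      by (rule has_sum_imp_sums)
    moreover have "(\<lambda>j. \<phi> j w * u ^ j) sums F (u, w)"
      using holomorphic_power_series[of "\<lambda>u. F (u, w)" 0 1 u] hol u w
      by (simp add: separately_holomorphic_def \<phi>_def)
    ultimately have "infsum ?t (UNIV \<times> UNIV) = F z"
      unfolding zuw by (rule sums_unique2)
    with total show ?thesis
      by simp
  qed
  with bound show ?thesis
    by (rule that)
qed

lemma bounded_on_bidisks_power_series:
  assumes "locally_summable a"
  shows "bounded_on_bidisks (power_series a)"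
  unfolding bounded_on_bidisks_def
proof (intro allI impI)
  fix r :: real assume r: "0 < r" "r < 1"
  obtain N where N: "\<And>z. norm (fst z) \<le> r \<Longrightarrow> norm (snd z) \<le> r \<Longrightarrow>
      norm (power_series a z - truncation N a z) \<le> 1"
    using power_series_truncation[OF assms, of r 1] r by (metis less_imp_le order_refl zero_less_one)
  define C where "C = 1 + (\<Sum>k\<in>{..<N} \<times> {..<N}. norm (a k))"
  have "norm (power_series a z) \<le> C" if z: "norm (fst z) \<le> r" "norm (snd z) \<le> r" for z
  proof -
    have "norm (bimonomial z k *s a k) \<le> norm (a k)" for k
      using norm_bimonomial_le[of z 1 k] z r
      by (simp add: norm_smult_complex mult_left_le_one_le)
    then have "norm (truncation N a z) \<le> (\<Sum>k\<in>{..<N} \<times> {..<N}. norm (a k))"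
      unfolding truncation_def by (intro sum_norm_le)
    then show ?thesis
      using N[OF z] norm_triangle_ineq2[of "power_series a z" "truncation N a z"]
      by (simp add: C_def)
  qed
  then show "\<exists>C. \<forall>z. norm (fst z) \<le> r \<longrightarrow> norm (snd z) \<le> r \<longrightarrow> norm (power_series a z) \<le> C"
    by blast
qed

text \<open>The map \<open>h\<close> embeds a disk into the bidisk with one coordinate frozen at \<open>x\<close>; both kinds of slices
  are treated at once. The slice is a locally uniform limit of polynomials.\<close>

lemma holomorphic_power_series_slice:
  assumes a: "locally_summable a" and x: "norm x < 1"
    and h: "\<And>y r. norm y \<le> r \<Longrightarrow> norm x \<le> r \<Longrightarrow> norm (fst (h y)) \<le> r \<and> norm (snd (h y)) \<le> r"
    and trunc: "\<And>N. (\<lambda>y. truncation N a (h y) $ i) holomorphic_on ball 0 1"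
  shows "(\<lambda>y. power_series a (h y) $ i) holomorphic_on ball 0 1"
proof (rule holomorphic_uniform_sequence[of _ "\<lambda>N y. truncation N a (h y) $ i"])
  fix w0 :: complex assume w0: "w0 \<in> ball 0 1"
  define r where "r = max (norm x) ((1 + norm w0) / 2)"
  have r: "0 \<le> r" "r < 1"
    using w0 x by (auto simp: r_def le_max_iff_disj)
  define d where "d = (1 - norm w0) / 2"
  have near: "norm w \<le> r" if "w \<in> cball w0 d" for w
  proof -
    have "norm w \<le> norm w0 + norm (w - w0)"
      using norm_triangle_ineq[of w0 "w - w0"] by simp
    with that have "norm w \<le> (1 + norm w0) / 2"
      by (simp add: dist_norm norm_minus_commute d_def field_simps)
    then show ?thesis
      unfolding r_def by (rule max.coboundedI2)
  qed
  have "uniform_limit (cball w0 d) (\<lambda>N y. truncation N a (h y) $ i) (\<lambda>y. power_series a (h y) $ i) sequentially"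
    unfolding uniform_limit_sequentially_iff
  proof (intro allI impI)
    fix e :: real assume "e > 0"
    then obtain N0 where N0: "\<And>N z. N0 \<le> N \<Longrightarrow> norm (fst z) \<le> r \<Longrightarrow> norm (snd z) \<le> r \<Longrightarrow>
        norm (power_series a z - truncation N a z) \<le> e / 2"
      using power_series_truncation[OF a r, of "e / 2"] by (metis half_gt_zero)
    have "dist (truncation N a (h y) $ i) (power_series a (h y) $ i) < e"
      if "N \<ge> N0" "y \<in> cball w0 d" for N y
    proof -
      have "norm (power_series a (h y) - truncation N a (h y)) \<le> e / 2"
        using h[OF near[OF that(2)]] by (intro N0 that(1)) (auto simp: r_def)
      then show ?thesis
        using Finite_Cartesian_Product.norm_nth_le[of "power_series a (h y) - truncation N a (h y)" i] \<open>e > 0\<close>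
        by (simp add: dist_norm norm_minus_commute)
    qed
    then show "\<exists>N. \<forall>n\<ge>N. \<forall>y\<in>cball w0 d. dist (truncation n a (h y) $ i) (power_series a (h y) $ i) < e"
      by blast
  qed
  moreover have "0 < d"
    using w0 by (simp add: d_def)
  moreover have "cball w0 d \<subseteq> ball 0 1"
    using near r by fastforce
  ultimately show "\<exists>d>0. cball w0 d \<subseteq> ball 0 1 \<and> uniform_limit (cball w0 d)
      (\<lambda>N y. truncation N a (h y) $ i) (\<lambda>y. power_series a (h y) $ i) sequentially"
    by blast
qed (use trunc in auto)

lemma separately_holomorphic_power_series:
  assumes "locally_summable a"
  shows "separately_holomorphic (\<lambda>z. power_series a z $ i)"
proof -
  have "(\<lambda>u. power_series a (u, w) $ i) holomorphic_on ball 0 1" if "norm w < 1" for w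
    by (rule holomorphic_power_series_slice[OF assms that, where h = "\<lambda>u. (u, w)"])
       (auto simp: truncation_def bimonomial_def sum_component intro!: holomorphic_intros)
  moreover have "(\<lambda>w. power_series a (u, w) $ i) holomorphic_on ball 0 1" if "norm u < 1" for u
    by (rule holomorphic_power_series_slice[OF assms that, where h = "\<lambda>w. (u, w)"])
       (auto simp: truncation_def bimonomial_def sum_component intro!: holomorphic_intros)
  ultimately show ?thesis
    by (auto simp: separately_holomorphic_def)
qed

lemma separately_holomorphic_if_holomorphic2:
  assumes "holomorphic2 f"
  shows "separately_holomorphic f"
proof -
  have diff: "(\<lambda>u. f (u, w)) field_differentiable at u" "(\<lambda>w. f (u, w)) field_differentiable at w"
    if "norm u < 1" "norm w < 1" for u w
  proof -
    have "(u, w) \<in> bidisk"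
      using that by (simp add: mem_bidisk_iff)
    then obtain a b where f: "(f has_derivative (\<lambda>h. a * fst h + b * snd h)) (at (u, w))"
      using assms unfolding holomorphic2_def by blast
    have "((\<lambda>u. (u, w)) has_derivative (\<lambda>h. (h, 0))) (at u)"
      by (auto intro!: derivative_eq_intros)
    from has_derivative_compose[OF this f]
    show "(\<lambda>u. f (u, w)) field_differentiable at u"
      unfolding field_differentiable_def has_field_derivative_def by auto
    have "((\<lambda>w. (u, w)) has_derivative (\<lambda>h. (0, h))) (at w)"
      by (auto intro!: derivative_eq_intros)
    from has_derivative_compose[OF this f]
    show "(\<lambda>w. f (u, w)) field_differentiable at w"
      unfolding field_differentiable_def has_field_derivative_def by auto
  qed
  show ?thesis
    unfolding separately_holomorphic_def holomorphic_on_def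
    by (intro conjI ballI; rule field_differentiable_at_within, rule diff; simp)
qed


section \<open>Bounded analytic multipliers of the Hardy space\<close>

lemma norm_vec_le_sum: "norm (x :: complex ^ 'd::finite) \<le> (\<Sum>i\<in>UNIV. norm (x $ i))"
  unfolding norm_vec_def by (rule L2_set_le_sum) simp

lemma norm_matrix_vector_le:
  fixes A :: "complex ^ 'd::finite ^ 'd"
  assumes "\<And>i j. norm (A $ i $ j) \<le> M"
  shows "norm (A *v x) \<le> real (CARD('d)) * (real (CARD('d)) * M) * norm x"
proof -
  have M: "0 \<le> M"
    using assms norm_ge_zero order_trans by blast
  have "norm (A *v x) \<le> (\<Sum>i\<in>UNIV. norm ((A *v x) $ i))"
    by (rule norm_vec_le_sum)
  also have "\<dots> \<le> (\<Sum>i\<in>(UNIV :: 'd set). \<Sum>j\<in>(UNIV :: 'd set). M * norm x)"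
  proof (rule sum_mono)
    fix i
    have "norm ((A *v x) $ i) \<le> (\<Sum>j\<in>UNIV. norm (A $ i $ j * x $ j))"
      unfolding matrix_vector_mult_def by (simp add: norm_sum)
    also have "\<dots> \<le> (\<Sum>j\<in>(UNIV :: 'd set). M * norm x)"
      unfolding norm_mult
      by (intro sum_mono mult_mono assms M Finite_Cartesian_Product.norm_nth_le) simp
    finally show "norm ((A *v x) $ i) \<le> (\<Sum>j\<in>(UNIV :: 'd set). M * norm x)" .
  qed
  finally show ?thesis
    by (simp add: mult_ac)
qed

text \<open>Every component of \<open>\<Theta> f\<close> is separately holomorphic and bounded on smaller bidisks, hence a double
  power series. As \<open>\<Theta>\<close> is bounded, \<open>norm (\<Theta> f) \<le> C * norm f\<close> pointwise, and this bound passes to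
  the square sums of the coefficients.\<close>

theorem inner_function_multiplier:
  fixes \<Theta> :: "'d::finite mfun"
  assumes \<Theta>: "inner_function \<Theta>" and f: "f \<in> H2"
  shows "(\<lambda>z. \<Theta> z *v f z) \<in> H2"
proof -
  obtain a where a: "square_summable a" "f = power_series a"
    using f by (auto simp: H2_def)
  have la: "locally_summable a"
    using a(1) by (rule square_summable_imp_locally_summable)
  obtain M0 where M0: "\<And>z. z \<in> bidisk \<Longrightarrow> norm (\<Theta> z) \<le> M0"
    using \<Theta> unfolding inner_function_def bounded_iff by blast
  have M: "norm (\<Theta> z $ i $ j) \<le> M0" if "z \<in> bidisk" for z i j
    using M0[OF that] Finite_Cartesian_Product.norm_nth_le[of "\<Theta> z" i]
      Finite_Cartesian_Product.norm_nth_le[of "\<Theta> z $ i" j] by linarith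
  define C where "C = real (CARD('d)) * (real (CARD('d)) * M0)"
  have le: "norm (\<Theta> z *v x) \<le> C * norm x" if "z \<in> bidisk" for z x
    unfolding C_def using M[OF that] by (rule norm_matrix_vector_le)
  have "(0, 0) \<in> bidisk"
    by (simp add: mem_bidisk_iff)
  then have "0 \<le> M0"
    using M0 norm_ge_zero order_trans by blast
  then have C0: "0 \<le> C"
    by (simp add: C_def)
  define F where "F i z = (\<Theta> z *v f z) $ i" for i z
  have "\<exists>c :: nat \<times> nat \<Rightarrow> complex. (\<forall>r>0. r < 1 \<longrightarrow> (\<exists>C. \<forall>k. norm (c k) * r ^ (fst k + snd k) \<le> C)) \<and>
      (\<forall>z\<in>bidisk. ((\<lambda>k. bimonomial z k * c k) has_sum F i z) UNIV)" for i
  proof -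
    have "separately_holomorphic (\<lambda>z. \<Theta> z $ i $ j)" for j
      using \<Theta> by (intro separately_holomorphic_if_holomorphic2) (simp add: inner_function_def)
    moreover have "separately_holomorphic (\<lambda>z. f z $ j)" for j
      unfolding a(2) using la by (rule separately_holomorphic_power_series)
    ultimately have "separately_holomorphic (F i)"
      unfolding separately_holomorphic_def F_def matrix_vector_mult_def
      by (auto intro!: holomorphic_intros)
    moreover have "bounded_on_bidisks (F i)"
      unfolding bounded_on_bidisks_def
    proof (intro allI impI)
      fix r :: real assume r: "0 < r" "r < 1"
      obtain B where B: "\<And>z. norm (fst z) \<le> r \<Longrightarrow> norm (snd z) \<le> r \<Longrightarrow> norm (f z) \<le> B"
        using bounded_on_bidisks_power_series[OF la] r
        unfolding a(2) bounded_on_bidisks_def by blast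
      have "norm (F i z) \<le> C * B" if z: "norm (fst z) \<le> r" "norm (snd z) \<le> r" for z
      proof -
        have zb: "z \<in> bidisk"
          using z r by (simp add: mem_bidisk_iff)
        have "norm (F i z) \<le> C * norm (f z)"
          using le[OF zb, of "f z"] Finite_Cartesian_Product.norm_nth_le[of "\<Theta> z *v f z" i]
          unfolding F_def by linarith
        also have "\<dots> \<le> C * B"
          using B[OF z] C0 by (rule mult_left_mono)
        finally show ?thesis .
      qed
      then show "\<exists>C. \<forall>z. norm (fst z) \<le> r \<longrightarrow> norm (snd z) \<le> r \<longrightarrow> norm (F i z) \<le> C"
        by blast
    qed
    ultimately show ?thesis
      using double_power_series_expansion[of "F i"] by metis
  qed
  then have "\<forall>i. \<exists>c :: nat \<times> nat \<Rightarrow> complex.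
      (\<forall>r>0. r < 1 \<longrightarrow> (\<exists>C. \<forall>k. norm (c k) * r ^ (fst k + snd k) \<le> C)) \<and>
      (\<forall>z\<in>bidisk. ((\<lambda>k. bimonomial z k * c k) has_sum F i z) UNIV)" ..
  from choice[OF this] obtain c :: "'d \<Rightarrow> nat \<times> nat \<Rightarrow> complex" where
    c: "\<And>i r. 0 < r \<Longrightarrow> r < 1 \<Longrightarrow> \<exists>C. \<forall>k. norm (c i k) * r ^ (fst k + snd k) \<le> C" and
    F: "\<And>i z. z \<in> bidisk \<Longrightarrow> ((\<lambda>k. bimonomial z k * c i k) has_sum F i z) UNIV"
    by blast
  define b where "b k = (\<chi> i. c i k)" for k
  have lb: "locally_summable b"
  proof (rule locally_summableI)
    fix r :: real assume r: "0 < r" "r < 1"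
    then have "\<forall>i. \<exists>C. \<forall>k. norm (c i k) * r ^ (fst k + snd k) \<le> C"
      using c by blast
    from choice[OF this] obtain B where B: "\<And>i k. norm (c i k) * r ^ (fst k + snd k) \<le> B i"
      by blast
    have "norm (b k) * r ^ (fst k + snd k) \<le> (\<Sum>i\<in>UNIV. B i)" for k
    proof -
      have "norm (b k) * r ^ (fst k + snd k) \<le> (\<Sum>i\<in>UNIV. norm (b k $ i)) * r ^ (fst k + snd k)"
        using r by (intro mult_right_mono norm_vec_le_sum) auto
      also have "\<dots> = (\<Sum>i\<in>UNIV. norm (c i k) * r ^ (fst k + snd k))"
        by (simp add: b_def sum_distrib_right)
      also have "\<dots> \<le> (\<Sum>i\<in>UNIV. B i)"
        by (intro sum_mono B)
      finally show ?thesis .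
    qed
    then show "\<exists>C. \<forall>k. norm (b k) * r ^ (fst k + snd k) \<le> C"
      by blast
  qed
  have eq: "power_series b z = \<Theta> z *v f z" if "z \<in> bidisk" for z
  proof -
    have "power_series b z $ i = F i z" for i
    proof -
      have "((\<lambda>k. (bimonomial z k *s b k) $ i) has_sum (power_series b z $ i)) UNIV"
        by (intro has_sum_bounded_linear[OF bounded_linear_vec_nth] has_sum_power_series lb that)
      then show ?thesis
        using F[OF that, of i] has_sum_unique by (simp add: b_def) blast
    qed
    then show ?thesis
      by (simp add: vec_eq_iff F_def)
  qed
  have "square_summable b"
    by (rule square_summable_if_dominated[OF lb a(1) C0]) (use eq le a(2) in simp)
  moreover have "(\<lambda>z. \<Theta> z *v f z) = power_series b"
  proof
    fix z
    show "\<Theta> z *v f z = power_series b z"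
      using eq[of z] by (cases "z \<in> bidisk") (simp_all add: a(2) power_series_off_bidisk)
  qed
  ultimately show ?thesis
    by (auto simp: H2_def)
qed


section \<open>The Hardy space as a Hilbert space of functions\<close>

lemma square_summable_scale:
  assumes "square_summable a"
  shows "square_summable (\<lambda>k. c *s a k)"
  using summable_on_cmult_right[OF assms[unfolded square_summable_def], of "(norm c)\<^sup>2"]
  by (simp add: square_summable_def norm_smult_complex power_mult_distrib)

lemma square_summable_add:
  assumes "square_summable a" "square_summable b"
  shows "square_summable (\<lambda>k. a k + b k)"
  unfolding square_summable_def
proof (rule summable_on_comparison_test)
  show "(\<lambda>k. 2 * (norm (a k))\<^sup>2 + 2 * (norm (b k))\<^sup>2) summable_on UNIV"
    using assms unfolding square_summable_def by (intro summable_on_add summable_on_cmult_right)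
  fix k
  have "(norm (a k + b k))\<^sup>2 \<le> (norm (a k) + norm (b k))\<^sup>2"
    by (intro power_mono norm_triangle_ineq) simp
  also have "\<dots> \<le> 2 * (norm (a k))\<^sup>2 + 2 * (norm (b k))\<^sup>2"
    using sum_squares_bound[of "norm (a k)" "norm (b k)"] by (simp add: power2_sum)
  finally show "(norm (a k + b k))\<^sup>2 \<le> 2 * (norm (a k))\<^sup>2 + 2 * (norm (b k))\<^sup>2" .
qed simp

lemma square_summable_diff:
  assumes "square_summable a" "square_summable b"
  shows "square_summable (\<lambda>k. a k - b k)"
  using square_summable_add[OF assms(1) square_summable_scale[OF assms(2), of "- 1"]]
  by simp

lemma square_summable_zero [simp]: "square_summable (\<lambda>k. 0)"
  by (simp add: square_summable_def)

lemma bounded_linear_smult: "bounded_linear (\<lambda>x :: complex ^ 'd::finite. c *s x)"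
  by (rule bounded_linear_intro[where K = "norm c"])
     (simp_all add: vec_eq_iff algebra_simps norm_smult_complex)

lemma bounded_linear_cip: "bounded_linear (\<lambda>x. cip x \<eta>)"
  unfolding cip_def
  by (intro bounded_linear_sum bounded_linear_compose[OF bounded_linear_mult_left bounded_linear_vec_nth])

lemma power_series_add:
  assumes "square_summable a" "square_summable b"
  shows "power_series (\<lambda>k. a k + b k) = power_series a + power_series b"
proof
  fix z
  show "power_series (\<lambda>k. a k + b k) z = (power_series a + power_series b) z"
  proof (cases "z \<in> bidisk")
    case True
    have "((\<lambda>k. bimonomial z k *s (a k + b k)) has_sum power_series a z + power_series b z) UNIV"
      using has_sum_add[OF has_sum_power_series[OF _ True] has_sum_power_series[OF _ True], of a b] assms
      by (simp add: vector_add_ldistrib square_summable_imp_locally_summable)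
    with True have "power_series (\<lambda>k. a k + b k) z = power_series a z + power_series b z"
      by (rule power_series_eqI)
    then show ?thesis by simp
  qed (simp add: power_series_off_bidisk)
qed

lemma power_series_scale:
  assumes "square_summable a"
  shows "power_series (\<lambda>k. c *s a k) = vscale c (power_series a)"
proof
  fix z
  show "power_series (\<lambda>k. c *s a k) z = vscale c (power_series a) z"
  proof (cases "z \<in> bidisk")
    case True
    have "((\<lambda>k. bimonomial z k *s (c *s a k)) has_sum c *s power_series a z) UNIV"
      using has_sum_bounded_linear[OF bounded_linear_smult has_sum_power_series[OF _ True], of a c] assms
      by (simp add: vector_smult_assoc mult.commute square_summable_imp_locally_summable)
    then show ?thesis
      using True by (simp add: power_series_eqI vscale_def)
  qed (simp add: power_series_off_bidisk vscale_def)
qed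

lemma power_series_inj:
  assumes a: "square_summable a" and b: "square_summable b" and eq: "power_series a = power_series b"
  shows "a = b"
proof
  fix k
  have "power_series (\<lambda>k. a k + (- 1) *s b k) = power_series a + vscale (- 1) (power_series b)"
    using a b by (simp only: power_series_add square_summable_scale power_series_scale)
  from fun_cong[OF this] have "power_series (\<lambda>k. a k + (- 1) *s b k) z = 0" for z
    using eq by (simp add: vscale_def)
  then have "a k + (- 1) *s b k = 0"
    by (rule power_series_eq_0_imp[OF square_summable_imp_locally_summable[OF
          square_summable_add[OF a square_summable_scale[OF b]]]])
  then show "a k = b k"
    by (simp add: vec_eq_iff)
qed

lemma power_series_in_H2: "square_summable a \<Longrightarrow> power_series a \<in> H2"
  by (auto simp: H2_def)

lemma taylor_coeff_power_series:
  assumes "square_summable a"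
  shows "taylor_coeff (power_series a) = a"
  unfolding taylor_coeff_def using assms power_series_inj by (intro the_equality) blast+

lemma
  assumes "f \<in> H2"
  shows square_summable_taylor_coeff: "square_summable (taylor_coeff f)"
    and power_series_taylor_coeff: "power_series (taylor_coeff f) = f"
proof -
  obtain a where "square_summable a" "f = power_series a"
    using assms by (auto simp: H2_def)
  then show "square_summable (taylor_coeff f)" "power_series (taylor_coeff f) = f"
    by (simp_all add: taylor_coeff_power_series)
qed

lemma H2_off_bidisk: "f \<in> H2 \<Longrightarrow> z \<notin> bidisk \<Longrightarrow> f z = 0"
  by (metis power_series_taylor_coeff power_series_off_bidisk)

lemma H2_eqI:
  assumes "f \<in> H2" "g \<in> H2" "\<And>k. taylor_coeff f k = taylor_coeff g k"
  shows "f = g"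
proof -
  have "f = power_series (taylor_coeff f)"
    by (rule power_series_taylor_coeff[OF assms(1), symmetric])
  also have "taylor_coeff f = taylor_coeff g"
    using assms(3) by (rule ext)
  also have "power_series (taylor_coeff g) = g"
    by (rule power_series_taylor_coeff[OF assms(2)])
  finally show ?thesis .
qed

lemma H2_add: "f \<in> H2 \<Longrightarrow> g \<in> H2 \<Longrightarrow> f + g \<in> H2"
  and taylor_coeff_add: "f \<in> H2 \<Longrightarrow> g \<in> H2 \<Longrightarrow> taylor_coeff (f + g) k = taylor_coeff f k + taylor_coeff g k"
proof -
  assume fg: "f \<in> H2" "g \<in> H2"
  have sq: "square_summable (\<lambda>k. taylor_coeff f k + taylor_coeff g k)"
    using fg by (intro square_summable_add square_summable_taylor_coeff)
  have "f + g = power_series (\<lambda>k. taylor_coeff f k + taylor_coeff g k)"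
    using fg by (simp add: power_series_add square_summable_taylor_coeff power_series_taylor_coeff)
  then show "f + g \<in> H2" "taylor_coeff (f + g) k = taylor_coeff f k + taylor_coeff g k"
    using sq by (simp_all add: power_series_in_H2 taylor_coeff_power_series)
qed

lemma H2_scale: "f \<in> H2 \<Longrightarrow> vscale c f \<in> H2"
  and taylor_coeff_scale: "f \<in> H2 \<Longrightarrow> taylor_coeff (vscale c f) k = c *s taylor_coeff f k"
proof -
  assume f: "f \<in> H2"
  have sq: "square_summable (\<lambda>k. c *s taylor_coeff f k)"
    using f by (intro square_summable_scale square_summable_taylor_coeff)
  have "vscale c f = power_series (\<lambda>k. c *s taylor_coeff f k)"
    using f by (simp add: power_series_scale square_summable_taylor_coeff power_series_taylor_coeff)
  then show "vscale c f \<in> H2" "taylor_coeff (vscale c f) k = c *s taylor_coeff f k"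
    using sq by (simp_all add: power_series_in_H2 taylor_coeff_power_series)
qed

lemma power_series_zero: "power_series (\<lambda>k. 0) = 0"
  by (rule ext) (simp add: power_series_eq)

lemma H2_zero: "0 \<in> H2"
  using power_series_in_H2[OF square_summable_zero] by (simp add: power_series_zero)

lemma taylor_coeff_zero: "taylor_coeff (0 :: 'd::finite vfun) k = 0"
proof -
  have "taylor_coeff (power_series (\<lambda>k. 0 :: complex ^ 'd)) = (\<lambda>k. 0)"
    by (rule taylor_coeff_power_series) simp
  then show ?thesis
    by (simp add: power_series_zero)
qed

lemma subspace_H2: "vfun.subspace H2"
  by (simp add: vfun.subspace_def H2_zero H2_add H2_scale)

lemma H2_diff: "f \<in> H2 \<Longrightarrow> g \<in> H2 \<Longrightarrow> f - g \<in> H2"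
  by (rule vfun.subspace_diff[OF subspace_H2])

lemma taylor_coeff_diff:
  "f \<in> H2 \<Longrightarrow> g \<in> H2 \<Longrightarrow> taylor_coeff (f - g) k = taylor_coeff f k - taylor_coeff g k"
  using taylor_coeff_add[of "f - g" g k] by (simp add: H2_diff)

lemma has_sum_H2_ip:
  assumes "f \<in> H2" "g \<in> H2"
  shows "((\<lambda>k. cip (taylor_coeff f k) (taylor_coeff g k)) has_sum H2_ip f g) UNIV"
proof -
  have "(\<lambda>k. (norm (taylor_coeff f k))\<^sup>2 + (norm (taylor_coeff g k))\<^sup>2) summable_on UNIV"
    using assms[THEN square_summable_taylor_coeff] unfolding square_summable_def
    by (rule summable_on_add)
  then have "(\<lambda>k. norm (cip (taylor_coeff f k) (taylor_coeff g k))) summable_on UNIV"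
    by (rule summable_on_comparison_test) (auto intro: norm_cip_le)
  then show ?thesis
    unfolding H2_ip_def by (rule has_sum_infsum[OF abs_summable_summable])
qed

lemma H2_ip_self:
  assumes "f \<in> H2"
  shows "H2_ip f f = of_real (\<Sum>\<^sub>\<infinity>k. (norm (taylor_coeff f k))\<^sup>2)"
proof -
  have "((\<lambda>k. complex_of_real ((norm (taylor_coeff f k))\<^sup>2)) has_sum
      of_real (\<Sum>\<^sub>\<infinity>k. (norm (taylor_coeff f k))\<^sup>2)) UNIV"
    using square_summable_taylor_coeff[OF assms] unfolding square_summable_def
    by (intro has_sum_of_real has_sum_infsum)
  then show ?thesis
    unfolding H2_ip_def cip_self by (rule infsumI)
qed

text \<open>Taylor coefficients turn this into completeness of a space of square summable families: a Cauchy
  sequence converges coefficientwise, and the Cauchy estimate over finite index sets survives the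
  limit.\<close>

lemma H2_complete:
  fixes X :: "nat \<Rightarrow> 'd::finite vfun"
  assumes X: "range X \<subseteq> H2"
    and Cauchy: "\<And>e. 0 < e \<Longrightarrow>
      \<exists>N. \<forall>m\<ge>N. \<forall>n\<ge>N. sqrt (Re (H2_ip (X m - X n) (X m - X n))) < e"
  shows "\<exists>L\<in>H2. (\<lambda>n. sqrt (Re (H2_ip (X n - L) (X n - L)))) \<longlonglongrightarrow> 0"
proof -
  define x where "x n = taylor_coeff (X n)" for n
  have XH: "X n \<in> H2" for n
    using X by auto
  have sx: "square_summable (x n)" for n
    unfolding x_def by (intro square_summable_taylor_coeff XH)
  have part: "L2_set (\<lambda>k. norm (x m k - x n k)) F \<le> sqrt (Re (H2_ip (X m - X n) (X m - X n)))"
    if "finite F" for m n F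
  proof -
    have "(\<Sum>k\<in>F. (norm (x m k - x n k))\<^sup>2) \<le> (\<Sum>\<^sub>\<infinity>k. (norm (x m k - x n k))\<^sup>2)"
      using square_summable_diff[OF sx sx] that unfolding square_summable_def
      by (intro finite_sum_le_infsum) auto
    then show ?thesis
      by (simp add: L2_set_def H2_ip_self H2_diff XH taylor_coeff_diff x_def)
  qed
  have conv: "convergent (\<lambda>n. x n k)" for k
  proof (rule Cauchy_convergent, rule CauchyI)
    fix e :: real assume "0 < e"
    then obtain N where "\<forall>m\<ge>N. \<forall>n\<ge>N. sqrt (Re (H2_ip (X m - X n) (X m - X n))) < e"
      using Cauchy by blast
    moreover have "norm (x m k - x n k) \<le> sqrt (Re (H2_ip (X m - X n) (X m - X n)))" for m n
      using part[of "{k}" m n] by (simp add: L2_set_def)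
    ultimately show "\<exists>N. \<forall>m\<ge>N. \<forall>n\<ge>N. norm (x m k - x n k) < e"
      by (meson le_less_trans)
  qed
  define a where "a k = lim (\<lambda>n. x n k)" for k
  have a: "(\<lambda>n. x n k) \<longlonglongrightarrow> a k" for k
    using conv unfolding a_def by (simp add: convergent_LIMSEQ_iff)
  have bound: "\<exists>N. \<forall>m\<ge>N. \<forall>F. finite F \<longrightarrow> (\<Sum>k\<in>F. (norm (x m k - a k))\<^sup>2) \<le> e\<^sup>2" if e: "0 < e" for e
  proof -
    obtain N where N: "\<forall>m\<ge>N. \<forall>n\<ge>N. sqrt (Re (H2_ip (X m - X n) (X m - X n))) < e"
      using Cauchy[OF e] by blast
    have "(\<Sum>k\<in>F. (norm (x m k - a k))\<^sup>2) \<le> e\<^sup>2" if "m \<ge> N" "finite F" for m F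
    proof (rule LIMSEQ_le_const2)
      show "(\<lambda>n. \<Sum>k\<in>F. (norm (x m k - x n k))\<^sup>2) \<longlonglongrightarrow> (\<Sum>k\<in>F. (norm (x m k - a k))\<^sup>2)"
        by (intro tendsto_intros a)
      have "(\<Sum>k\<in>F. (norm (x m k - x n k))\<^sup>2) \<le> e\<^sup>2" if "n \<ge> N" for n
      proof -
        have "L2_set (\<lambda>k. norm (x m k - x n k)) F \<le> e"
          using part[OF \<open>finite F\<close>, of m n] N \<open>m \<ge> N\<close> that by (meson less_imp_le order_trans)
        then show ?thesis
          using power_mono[of "L2_set (\<lambda>k. norm (x m k - x n k)) F" e 2]
          by (simp add: L2_set_def real_sqrt_pow2 sum_nonneg)
      qed
      then show "\<exists>N. \<forall>n\<ge>N. (\<Sum>k\<in>F. (norm (x m k - x n k))\<^sup>2) \<le> e\<^sup>2"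
        by blast
    qed
    then show ?thesis by blast
  qed
  have sd: "square_summable (\<lambda>k. x m k - a k)"
    if "\<And>F. finite F \<Longrightarrow> (\<Sum>k\<in>F. (norm (x m k - a k))\<^sup>2) \<le> B" for m B
    unfolding square_summable_def
    by (rule nonneg_bdd_above_summable_on) (use that in \<open>auto intro!: bdd_aboveI[where M = B]\<close>)
  have sa: "square_summable a"
  proof -
    obtain N where "\<forall>m\<ge>N. \<forall>F. finite F \<longrightarrow> (\<Sum>k\<in>F. (norm (x m k - a k))\<^sup>2) \<le> 1\<^sup>2"
      using bound[OF zero_less_one] by blast
    then have "square_summable (\<lambda>k. x N k - a k)"
      by (intro sd) blast
    from square_summable_diff[OF sx[of N] this] show ?thesis
      by simp
  qed
  define L where "L = power_series a"
  have L: "L \<in> H2" "taylor_coeff L = a"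
    using sa by (simp_all add: L_def power_series_in_H2 taylor_coeff_power_series)
  have "(\<lambda>n. sqrt (Re (H2_ip (X n - L) (X n - L)))) \<longlonglongrightarrow> 0"
  proof (rule LIMSEQ_I)
    fix e :: real assume "0 < e"
    then obtain N where N: "\<And>m F. m \<ge> N \<Longrightarrow> finite F \<Longrightarrow> (\<Sum>k\<in>F. (norm (x m k - a k))\<^sup>2) \<le> (e / 2)\<^sup>2"
      using bound[OF half_gt_zero[OF \<open>0 < e\<close>]] by blast
    have "norm (sqrt (Re (H2_ip (X m - L) (X m - L))) - 0) < e" if "m \<ge> N" for m
    proof -
      have "(\<Sum>\<^sub>\<infinity>k. (norm (x m k - a k))\<^sup>2) \<le> (e / 2)\<^sup>2"
        using sd[OF N[OF that]] unfolding square_summable_def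
        by (intro infsum_le_finite_sums N that)
      then have "Re (H2_ip (X m - L) (X m - L)) \<le> (e / 2)\<^sup>2"
        by (simp add: H2_ip_self H2_diff XH L taylor_coeff_diff x_def)
      moreover have "0 \<le> Re (H2_ip (X m - L) (X m - L))"
        by (simp add: H2_ip_self H2_diff XH L infsum_nonneg)
      ultimately show ?thesis
        using real_sqrt_le_mono[of "Re (H2_ip (X m - L) (X m - L))" "(e / 2)\<^sup>2"] \<open>0 < e\<close> by simp
    qed
    then show "\<exists>N. \<forall>m\<ge>N. norm (sqrt (Re (H2_ip (X m - L) (X m - L))) - 0) < e"
      by blast
  qed
  with L(1) show ?thesis
    by blast
qed

theorem hilbert_space_on_H2: "hilbert_space_on (H2 :: 'd::finite vfun set) H2_ip"
  unfolding hilbert_space_on_def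
proof (intro conjI ballI allI impI)
  fix f g h :: "'d vfun" and c
  assume f: "f \<in> H2" and g: "g \<in> H2"
  have "((\<lambda>k. c * cip (taylor_coeff f k) (taylor_coeff g k)) has_sum H2_ip (vscale c f) g) UNIV"
    using has_sum_H2_ip[OF H2_scale[OF f, of c] g] by (simp add: taylor_coeff_scale f cip_scale_left)
  then show "H2_ip (vscale c f) g = c * H2_ip f g"
    by (rule has_sum_unique[OF _ has_sum_cmult_right[OF has_sum_H2_ip[OF f g]]])
  have "((\<lambda>k. cip (taylor_coeff g k) (taylor_coeff f k)) has_sum cnj (H2_ip f g)) UNIV"
    using has_sum_bounded_linear[OF bounded_linear_cnj has_sum_H2_ip[OF f g]]
    by (simp flip: cip_commute)
  then show "H2_ip g f = cnj (H2_ip f g)"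
    by (rule has_sum_unique[OF has_sum_H2_ip[OF g f]])
  assume h: "h \<in> H2"
  have "((\<lambda>k. cip (taylor_coeff f k) (taylor_coeff h k) + cip (taylor_coeff g k) (taylor_coeff h k))
      has_sum H2_ip (f + g) h) UNIV"
    using has_sum_H2_ip[OF H2_add[OF f g] h] by (simp add: taylor_coeff_add f g cip_add_left)
  then show "H2_ip (f + g) h = H2_ip f h + H2_ip g h"
    by (rule has_sum_unique[OF _ has_sum_add[OF has_sum_H2_ip[OF f h] has_sum_H2_ip[OF g h]]])
next
  fix f :: "'d vfun"
  assume f: "f \<in> H2"
  show "H2_ip f f \<in> \<real>\<^sub>\<ge>\<^sub>0"
    by (simp add: H2_ip_self f infsum_nonneg)
  assume "H2_ip f f = 0"
  then have zero: "(\<Sum>\<^sub>\<infinity>k. (norm (taylor_coeff f k))\<^sup>2) = 0"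
    by (simp add: H2_ip_self f)
  have "taylor_coeff f k = 0" for k
    using nonneg_infsum_le_0D[of "\<lambda>k. (norm (taylor_coeff f k))\<^sup>2" UNIV k] zero
      square_summable_taylor_coeff[OF f] by (simp add: square_summable_def)
  then show "f = 0"
    by (intro H2_eqI f H2_zero) (simp add: taylor_coeff_zero)
next
  fix X :: "nat \<Rightarrow> 'd vfun"
  assume X: "range X \<subseteq> H2 \<and>
    (\<forall>e>0. \<exists>N. \<forall>m\<ge>N. \<forall>n\<ge>N. sqrt (Re (H2_ip (X m - X n) (X m - X n))) < e)"
  show "\<exists>L\<in>H2. (\<lambda>n. sqrt (Re (H2_ip (X n - L) (X n - L)))) \<longlonglongrightarrow> 0"
    by (rule H2_complete[OF conjunct1[OF X] conjunct2[OF X, rule_format]])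
qed (rule subspace_H2)

interpretation H2: function_hilbert_space "H2 :: 'd::finite vfun set" H2_ip
  by unfold_locales (rule hilbert_space_on_H2)


section \<open>The Szego kernel, the shift and the backward shift\<close>

text \<open>The reproducing kernel of the Hardy space applied to \<open>\<eta>\<close>: in closed form
  \<open>\<eta> / ((1 - z\<^sub>1 w\<^sub>1*) (1 - z\<^sub>2 w\<^sub>2*))\<close>, where the star denotes complex conjugation.\<close>

definition szego :: "complex \<times> complex \<Rightarrow> complex ^ 'd::finite \<Rightarrow> 'd vfun" where
  "szego w \<eta> = power_series (\<lambda>k. cnj (bimonomial w k) *s \<eta>)"

lemma
  assumes w: "w \<in> bidisk"
  shows szego_in_H2: "szego w \<eta> \<in> H2"
    and H2_ip_szego: "f \<in> H2 \<Longrightarrow> H2_ip f (szego w \<eta>) = cip (f w) \<eta>"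
proof -
  define r where "r = max (norm (fst w)) (norm (snd w))"
  have r: "0 \<le> r" "r < 1"
    using w by (auto simp: mem_bidisk_iff r_def le_max_iff_disj)
  have sq: "square_summable (\<lambda>k. cnj (bimonomial w k) *s \<eta>)"
    unfolding square_summable_def
  proof (rule summable_on_comparison_test)
    show "(\<lambda>k::nat \<times> nat. (r\<^sup>2) ^ (fst k + snd k) * (norm \<eta>)\<^sup>2) summable_on UNIV"
      using r by (intro summable_on_cmult_left summable_on_geometric2) (simp_all add: power_less_one_iff)
    fix k
    have "(norm (bimonomial w k))\<^sup>2 \<le> (r ^ (fst k + snd k))\<^sup>2"
      using norm_bimonomial_le[of w r k] by (intro power_mono) (auto simp: r_def)
    then have "(norm (bimonomial w k))\<^sup>2 * (norm \<eta>)\<^sup>2 \<le> (r ^ (fst k + snd k))\<^sup>2 * (norm \<eta>)\<^sup>2"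
      by (rule mult_right_mono) simp
    also have "(r ^ (fst k + snd k))\<^sup>2 = (r\<^sup>2) ^ (fst k + snd k)"
      by (simp only: mult.commute flip: power_mult)
    finally show "(norm (cnj (bimonomial w k) *s \<eta>))\<^sup>2 \<le> (r\<^sup>2) ^ (fst k + snd k) * (norm \<eta>)\<^sup>2"
      by (simp only: norm_smult_complex complex_mod_cnj power_mult_distrib)
  qed simp
  then show H2: "szego w \<eta> \<in> H2"
    by (simp add: szego_def power_series_in_H2)
  assume f: "f \<in> H2"
  have "((\<lambda>k. cip (bimonomial w k *s taylor_coeff f k) \<eta>) has_sum cip (f w) \<eta>) UNIV"
    using has_sum_bounded_linear[OF bounded_linear_cip has_sum_power_series[OF
        square_summable_imp_locally_summable[OF square_summable_taylor_coeff[OF f]] w]]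
    by (simp add: power_series_taylor_coeff[OF f])
  moreover have "cip (bimonomial w k *s x) \<eta> = cip x (cnj (bimonomial w k) *s \<eta>)" for k x
    by (simp add: cip_def sum_distrib_left mult_ac)
  ultimately show "H2_ip f (szego w \<eta>) = cip (f w) \<eta>"
    by (simp add: H2_ip_def szego_def taylor_coeff_power_series[OF sq] infsumI)
qed

definition raise :: "nat \<times> nat \<Rightarrow> nat \<times> nat" where
  "raise k = (Suc (fst k), snd k)"

definition shift :: "(nat \<times> nat \<Rightarrow> 'a::zero) \<Rightarrow> nat \<times> nat \<Rightarrow> 'a" where
  "shift a k = (if fst k = 0 then 0 else a (fst k - 1, snd k))"

lemma shift_raise [simp]: "shift a (raise k) = a k"
  by (simp add: shift_def raise_def)

lemma inj_raise: "inj raise"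
  by (auto simp: inj_def raise_def prod_eq_iff)

lemma not_in_range_raise: "k \<notin> range raise \<longleftrightarrow> fst k = 0"
proof
  assume "k \<notin> range raise"
  then show "fst k = 0"
    by (metis Suc_pred' fst_conv neq0_conv prod.collapse raise_def rangeI snd_conv)
qed (auto simp: raise_def)

lemma has_sum_raise:
  assumes "\<And>k. fst k = 0 \<Longrightarrow> g k = 0"
  shows "((\<lambda>k. g (raise k)) has_sum s) UNIV \<longleftrightarrow> (g has_sum s) UNIV"
proof -
  have "(g has_sum s) UNIV \<longleftrightarrow> (g has_sum s) (range raise)"
    by (rule has_sum_cong_neutral) (use assms not_in_range_raise in auto)
  then show ?thesis
    using has_sum_reindex[OF inj_raise, of g s] by (simp add: o_def)
qed

lemma square_summable_shift:
  assumes "square_summable a"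
  shows "square_summable (shift a)"
proof -
  have "((\<lambda>k. (norm (shift a (raise k)))\<^sup>2) has_sum (\<Sum>\<^sub>\<infinity>k. (norm (a k))\<^sup>2)) UNIV"
    using assms has_sum_infsum unfolding square_summable_def by simp
  then have "((\<lambda>k. (norm (shift a k))\<^sup>2) has_sum (\<Sum>\<^sub>\<infinity>k. (norm (a k))\<^sup>2)) UNIV"
    by (subst (asm) has_sum_raise[of "\<lambda>k. (norm (shift a k))\<^sup>2"]) (simp_all add: shift_def)
  then show ?thesis
    unfolding square_summable_def by (rule has_sum_imp_summable)
qed

lemma square_summable_raise:
  assumes "square_summable a"
  shows "square_summable (\<lambda>k. a (raise k))"
proof -
  have "(\<lambda>k. (norm (a k))\<^sup>2) summable_on range raise"
    using assms unfolding square_summable_def by (rule summable_on_subset_banach) simp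
  then show ?thesis
    unfolding square_summable_def using summable_on_reindex[OF inj_raise] by (force simp: o_def)
qed

lemma mult_z1_power_series:
  assumes "square_summable a"
  shows "mult_z1 (power_series a) = power_series (shift a)"
proof
  fix z
  show "mult_z1 (power_series a) z = power_series (shift a) z"
  proof (cases "z \<in> bidisk")
    case True
    have "((\<lambda>k. fst z *s (bimonomial z k *s a k)) has_sum fst z *s power_series a z) UNIV"
      by (intro has_sum_bounded_linear[OF bounded_linear_smult] has_sum_power_series True
          square_summable_imp_locally_summable assms)
    also have "(\<lambda>k. fst z *s (bimonomial z k *s a k)) = (\<lambda>k. bimonomial z (raise k) *s shift a (raise k))"
      by (simp add: bimonomial_def raise_def shift_def vector_smult_assoc mult.assoc)
    finally have "((\<lambda>k. bimonomial z k *s shift a k) has_sum fst z *s power_series a z) UNIV"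
      by (subst (asm) has_sum_raise[of "\<lambda>k. bimonomial z k *s shift a k"]) (simp_all add: shift_def)
    then show ?thesis
      using True by (simp add: mult_z1_def power_series_eqI)
  qed (simp add: mult_z1_def power_series_off_bidisk)
qed

lemma mult_z1_in_H2: "f \<in> H2 \<Longrightarrow> mult_z1 f \<in> H2"
  and taylor_coeff_mult_z1: "f \<in> H2 \<Longrightarrow> taylor_coeff (mult_z1 f) = shift (taylor_coeff f)"
proof -
  assume f: "f \<in> H2"
  have "mult_z1 f = power_series (shift (taylor_coeff f))"
    using mult_z1_power_series[OF square_summable_taylor_coeff[OF f]] power_series_taylor_coeff[OF f] by simp
  moreover have "square_summable (shift (taylor_coeff f))"
    using f by (intro square_summable_shift square_summable_taylor_coeff)
  ultimately show "mult_z1 f \<in> H2" "taylor_coeff (mult_z1 f) = shift (taylor_coeff f)"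
    by (simp_all add: power_series_in_H2 taylor_coeff_power_series)
qed

lemma mult_z1_add: "mult_z1 (f + g) = mult_z1 f + mult_z1 g"
  and mult_z1_scale: "mult_z1 (vscale c f) = vscale c (mult_z1 f)"
  by (auto simp: mult_z1_def vscale_def fun_eq_iff vec_eq_iff algebra_simps)

text \<open>This is \<open>(f(z\<^sub>1, z\<^sub>2) - f(0, z\<^sub>2)) / z\<^sub>1\<close>; it is the adjoint of multiplication by \<open>z\<^sub>1\<close>.\<close>

definition backward_shift :: "'d::finite vfun \<Rightarrow> 'd vfun" where
  "backward_shift f = power_series (\<lambda>k. taylor_coeff f (raise k))"

lemma backward_shift_in_H2: "f \<in> H2 \<Longrightarrow> backward_shift f \<in> H2"
  and taylor_coeff_backward_shift: "f \<in> H2 \<Longrightarrow> taylor_coeff (backward_shift f) k = taylor_coeff f (raise k)"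
  unfolding backward_shift_def using square_summable_raise[OF square_summable_taylor_coeff[of f]]
  by (simp_all add: power_series_in_H2 taylor_coeff_power_series)

lemma backward_shift_add:
  "f \<in> H2 \<Longrightarrow> g \<in> H2 \<Longrightarrow> backward_shift (f + g) = backward_shift f + backward_shift g"
  by (rule H2_eqI) (simp_all add: backward_shift_in_H2 H2_add taylor_coeff_add taylor_coeff_backward_shift)

lemma backward_shift_scale:
  "f \<in> H2 \<Longrightarrow> backward_shift (vscale c f) = vscale c (backward_shift f)"
  by (rule H2_eqI) (simp_all add: backward_shift_in_H2 H2_scale taylor_coeff_scale taylor_coeff_backward_shift)

lemma backward_shift_mult_z1: "f \<in> H2 \<Longrightarrow> backward_shift (mult_z1 f) = f"
  by (rule H2_eqI)
     (simp_all add: backward_shift_in_H2 mult_z1_in_H2 taylor_coeff_backward_shift taylor_coeff_mult_z1)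

lemma H2_ip_mult_z1_left:
  assumes f: "f \<in> H2" and g: "g \<in> H2"
  shows "H2_ip (mult_z1 f) g = H2_ip f (backward_shift g)"
proof -
  let ?s = "\<lambda>k. cip (taylor_coeff (mult_z1 f) k) (taylor_coeff g k)"
  have "((\<lambda>k. ?s (raise k)) has_sum H2_ip f (backward_shift g)) UNIV"
    using has_sum_H2_ip[OF f backward_shift_in_H2[OF g]] f g
    by (simp add: taylor_coeff_mult_z1 taylor_coeff_backward_shift)
  then have "(?s has_sum H2_ip f (backward_shift g)) UNIV"
    by (subst (asm) has_sum_raise[of ?s]) (simp_all add: f taylor_coeff_mult_z1 shift_def cip_zero_left)
  then show ?thesis
    by (rule has_sum_unique[OF has_sum_H2_ip[OF mult_z1_in_H2[OF f] g]])
qed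

lemma H2_ip_mult_z1_mult_z1:
  "f \<in> H2 \<Longrightarrow> g \<in> H2 \<Longrightarrow> H2_ip (mult_z1 f) (mult_z1 g) = H2_ip f g"
  by (simp add: H2_ip_mult_z1_left mult_z1_in_H2 backward_shift_mult_z1)


section \<open>Orthogonal projections and adjoints\<close>

lemma hilbert_space_on_orth_compl:
  assumes "hilbert_space_on V H2_ip" "M \<subseteq> V"
  shows "hilbert_space_on (V \<ominus> M) H2_ip"
proof -
  interpret function_hilbert_space V H2_ip
    by unfold_locales fact
  show ?thesis
  proof (rule hilbert_space_on_closed_subspace)
    show "V \<ominus> M \<subseteq> V"
      by (auto simp: orth_compl_def)
    show "vfun.subspace (V \<ominus> M)"
      using assms(2) by (auto simp: vfun.subspace_def orth_compl_def ip_add_left ip_scale_left subset_iff)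
    fix X L
    assume X: "\<And>n. X n \<in> V \<ominus> M" and L: "L \<in> V" "conv X L"
    have "H2_ip L g = 0" if "g \<in> M" for g
      by (rule annihilator_closed[OF assms(2) _ L _ that]) (use X in \<open>simp_all add: orth_compl_def\<close>)
    with L(1) show "L \<in> V \<ominus> M"
      by (simp add: orth_compl_def)
  qed
qed

lemma
  assumes M: "hilbert_space_on M H2_ip" "M \<subseteq> H2" and f: "f \<in> H2"
  shows orth_proj_in: "orth_proj M f \<in> M"
    and H2_ip_orth_proj: "h \<in> M \<Longrightarrow> H2_ip (orth_proj M f) h = H2_ip f h"
    and orth_proj_eqI: "g \<in> M \<Longrightarrow> (\<And>h. h \<in> M \<Longrightarrow> H2_ip g h = H2_ip f h) \<Longrightarrow> orth_proj M f = g"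
proof -
  note ex1 = H2.ex1_projection[OF M f]
  have P: "orth_proj M f \<in> M \<and> (\<forall>h\<in>M. H2_ip (f - orth_proj M f) h = 0)"
    unfolding orth_proj_def by (rule theI'[OF ex1])
  then show in_M: "orth_proj M f \<in> M" ..
  show "H2_ip (orth_proj M f) h = H2_ip f h" if "h \<in> M" for h
    using P H2.ip_diff_left[OF f subsetD[OF M(2) in_M] subsetD[OF M(2) that]] that by simp
  show "orth_proj M f = g" if g: "g \<in> M" and ip: "\<And>h. h \<in> M \<Longrightarrow> H2_ip g h = H2_ip f h"
  proof -
    have "H2_ip (f - g) h = 0" if "h \<in> M" for h
      using H2.ip_diff_left[OF f subsetD[OF M(2) g] subsetD[OF M(2) that]] ip[OF that] by simp
    with g show ?thesis
      unfolding orth_proj_def by (intro the1_equality[OF ex1]) blast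
  qed
qed

lemma orth_proj_add:
  assumes M: "hilbert_space_on M H2_ip" "M \<subseteq> H2" and f: "f \<in> H2" and g: "g \<in> H2"
  shows "orth_proj M (f + g) = orth_proj M f + orth_proj M g"
proof (rule orth_proj_eqI[OF M H2_add[OF f g]])
  interpret M: function_hilbert_space M H2_ip
    by unfold_locales fact
  show "orth_proj M f + orth_proj M g \<in> M"
    by (intro M.add_mem orth_proj_in M f g)
  fix h assume h: "h \<in> M"
  show "H2_ip (orth_proj M f + orth_proj M g) h = H2_ip (f + g) h"
    by (simp only: M.ip_add_left[OF orth_proj_in[OF M f] orth_proj_in[OF M g] h]
        H2.ip_add_left[OF f g subsetD[OF M(2) h]] H2_ip_orth_proj[OF M f h] H2_ip_orth_proj[OF M g h])
qed

lemma orth_proj_scale: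
  assumes M: "hilbert_space_on M H2_ip" "M \<subseteq> H2" and f: "f \<in> H2"
  shows "orth_proj M (vscale c f) = vscale c (orth_proj M f)"
proof (rule orth_proj_eqI[OF M H2_scale[OF f]])
  interpret M: function_hilbert_space M H2_ip
    by unfold_locales fact
  show "vscale c (orth_proj M f) \<in> M"
    by (intro M.scale_mem orth_proj_in M f)
  fix h assume h: "h \<in> M"
  show "H2_ip (vscale c (orth_proj M f)) h = H2_ip (vscale c f) h"
    by (simp only: M.ip_scale_left[OF orth_proj_in[OF M f] h]
        H2.ip_scale_left[OF f subsetD[OF M(2) h]] H2_ip_orth_proj[OF M f h])
qed

lemma hadjoint_eqI:
  assumes V: "vfun.subspace V" "V \<subseteq> H2" and h: "h \<in> V"
    and adj: "\<And>f. f \<in> V \<Longrightarrow> H2_ip (A f) g = H2_ip f h"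
  shows "hadjoint V A g = h"
  unfolding hadjoint_def
proof (rule the_equality)
  show "h \<in> V \<and> (\<forall>f\<in>V. H2_ip (A f) g = H2_ip f h)"
    using h adj by blast
  fix h' assume h': "h' \<in> V \<and> (\<forall>f\<in>V. H2_ip (A f) g = H2_ip f h')"
  let ?u = "h' - h"
  have u: "?u \<in> V"
    using h h' V(1) by (blast intro: vfun.subspace_diff)
  then have "H2_ip ?u h' = H2_ip ?u h"
    using h' adj by metis
  then have "H2_ip ?u ?u = 0"
    using H2.ip_diff_right[of ?u h' h] u h h' V(2) by (simp add: subset_iff)
  then have "?u = 0"
    using u V(2) by (intro H2.ip_self_eq_0) auto
  then show "h' = h"
    by simp
qed


section \<open>Reproducing kernels\<close>

lemma cip_axis: "cip x (axis j 1) = x $ j"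
  by (simp add: cip_def axis_def if_distrib cong: if_cong)

text \<open>The columns of the kernel are the projections of the Szego kernel functions.\<close>

theorem closed_subspace_has_reproducing_kernel:
  fixes M :: "'d::finite vfun set"
  assumes M: "hilbert_space_on M H2_ip" "M \<subseteq> H2"
  obtains k where "has_reproducing_kernel M H2_ip k"
proof -
  interpret M: function_hilbert_space M H2_ip
    by unfold_locales fact
  define c :: "complex \<times> complex \<Rightarrow> 'd \<Rightarrow> 'd vfun" where
    "c w j = orth_proj M (szego w (axis j 1))" for w j
  define k :: "'d kernel" where "k z w = (\<chi> i j. c w j z $ i)" for z w
  have c: "c w j \<in> M" "f \<in> M \<Longrightarrow> H2_ip f (c w j) = f w $ j" if w: "w \<in> bidisk" for w j f
  proof -
    show c: "c w j \<in> M"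
      unfolding c_def by (rule orth_proj_in[OF M szego_in_H2[OF w]])
    assume f: "f \<in> M"
    have "H2_ip (c w j) f = H2_ip (szego w (axis j 1)) f"
      unfolding c_def by (rule H2_ip_orth_proj[OF M szego_in_H2[OF w] f])
    then have "H2_ip f (c w j) = H2_ip f (szego w (axis j 1))"
      using M.ip_commute[OF c f] H2.ip_commute[OF szego_in_H2[OF w] subsetD[OF M(2) f]] by simp
    then show "H2_ip f (c w j) = f w $ j"
      using H2_ip_szego[OF w subsetD[OF M(2) f]] by (simp add: cip_axis)
  qed
  have "(\<lambda>z. k z w *v \<eta>) \<in> M \<and> (\<forall>f\<in>M. H2_ip f (\<lambda>z. k z w *v \<eta>) = cip (f w) \<eta>)"
    if w: "w \<in> bidisk" for w \<eta>
  proof -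
    have mem: "vscale (\<eta> $ j) (c w j) \<in> M" for j
      by (intro M.scale_mem c w)
    have "sum x J z = (\<Sum>j\<in>J. x j z)" for x :: "'d \<Rightarrow> 'd vfun" and J z
      by (induction J rule: infinite_finite_induct) auto
    then have eq: "(\<lambda>z. k z w *v \<eta>) = (\<Sum>j\<in>UNIV. vscale (\<eta> $ j) (c w j))"
      by (intro ext)
        (simp add: vscale_def vec_eq_iff matrix_vector_mult_def k_def sum_component mult.commute)
    have "H2_ip f (\<Sum>j\<in>UNIV. vscale (\<eta> $ j) (c w j)) = cip (f w) \<eta>" if f: "f \<in> M" for f
    proof -
      have "H2_ip f (\<Sum>j\<in>UNIV. vscale (\<eta> $ j) (c w j)) = (\<Sum>j\<in>UNIV. H2_ip f (vscale (\<eta> $ j) (c w j)))"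
        using mem f by (intro M.ip_sum_right) auto
      also have "\<dots> = cip (f w) \<eta>"
        using M.ip_scale_right[OF f c(1)[OF w]] c(2)[OF w f] by (simp add: cip_def mult.commute)
      finally show ?thesis .
    qed
    then show ?thesis
      unfolding eq using mem by (intro conjI ballI M.sum_mem)
  qed
  then have "has_reproducing_kernel M H2_ip k"
    unfolding has_reproducing_kernel_def using M(1) H2_off_bidisk subsetD[OF M(2)] by blast
  then show ?thesis
    by (rule that)
qed

lemma
  assumes "has_reproducing_kernel V ip k"
  shows reproducing_kernel_hilbert: "hilbert_space_on V ip"
    and reproducing_kernel_off: "f \<in> V \<Longrightarrow> z \<notin> bidisk \<Longrightarrow> f z = 0"
    and reproducing_kernel_in: "w \<in> bidisk \<Longrightarrow> (\<lambda>z. k z w *v \<eta>) \<in> V"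
    and reproducing_kernel_ip: "w \<in> bidisk \<Longrightarrow> f \<in> V \<Longrightarrow> ip f (\<lambda>z. k z w *v \<eta>) = cip (f w) \<eta>"
  using assms unfolding has_reproducing_kernel_def by blast+

text \<open>The difference of the two kernel functions at \<open>w\<close> is orthogonal to the whole space, in particular
  to itself.\<close>

lemma reproducing_kernel_unique:
  assumes k: "has_reproducing_kernel V ip k" and k': "has_reproducing_kernel V ip k'" and w: "w \<in> bidisk"
  shows "k z w = k' z w"
proof -
  interpret function_hilbert_space V ip
    by unfold_locales (rule reproducing_kernel_hilbert[OF k])
  have "k z w *v \<eta> = k' z w *v \<eta>" for \<eta>
  proof -
    let ?f = "\<lambda>z. k z w *v \<eta>" and ?g = "\<lambda>z. k' z w *v \<eta>"
    have fg: "?f \<in> V" "?g \<in> V"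
      by (rule reproducing_kernel_in[OF k w], rule reproducing_kernel_in[OF k' w])
    have d: "?f - ?g \<in> V"
      by (rule diff_mem[OF fg])
    have "ip (?f - ?g) (?f - ?g) = ip (?f - ?g) ?f - ip (?f - ?g) ?g"
      by (rule ip_diff_right[OF d fg])
    also have "\<dots> = 0"
      by (simp only: reproducing_kernel_ip[OF k w d] reproducing_kernel_ip[OF k' w d]) simp
    finally have "?f - ?g = 0"
      by (rule ip_self_eq_0[OF d])
    then have "?f = ?g"
      by simp
    then show ?thesis
      by (rule fun_cong)
  qed
  then show ?thesis
    by (simp add: matrix_eq)
qed

text \<open>The quadratic form of the kernel is the squared norm of a combination of kernel functions.\<close>

lemma positive_kernel_if_reproducing:
  assumes k: "has_reproducing_kernel V ip k"
    and off: "\<And>z w. (z, w) \<notin> bidisk \<times> bidisk \<Longrightarrow> k z w = 0"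
  shows "positive_kernel k"
proof -
  interpret function_hilbert_space V ip
    by unfold_locales (rule reproducing_kernel_hilbert[OF k])
  have "(\<Sum>i<N. \<Sum>j<N. cip (k (w i) (w j) *v \<eta> j) (\<eta> i)) \<in> \<real>\<^sub>\<ge>\<^sub>0"
    if w: "\<forall>i<N. w i \<in> bidisk" for N :: nat and w and \<eta> :: "nat \<Rightarrow> complex ^ 'a"
  proof -
    let ?k = "\<lambda>j z. k z (w j) *v \<eta> j"
    let ?s = "\<Sum>j<N. ?k j"
    have kV: "?k j \<in> V" if "j \<in> {..<N}" for j
      using w that by (intro reproducing_kernel_in[OF k]) auto
    have sV: "?s \<in> V"
      using kV by (rule sum_mem)
    have "ip ?s ?s = (\<Sum>i<N. ip ?s (?k i))"
      by (rule ip_sum_right[OF _ kV sV]) simp_all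
    also have "\<dots> = (\<Sum>i<N. \<Sum>j<N. ip (?k j) (?k i))"
      by (intro sum.cong refl ip_sum_left kV) auto
    also have "\<dots> = (\<Sum>i<N. \<Sum>j<N. cip (k (w i) (w j) *v \<eta> j) (\<eta> i))"
      using w by (intro sum.cong refl reproducing_kernel_ip[OF k] reproducing_kernel_in[OF k]) auto
    finally show ?thesis
      using ip_self_nonneg[OF sV] by simp
  qed
  then show ?thesis
    using off unfolding positive_kernel_def by blast
qed


section \<open>Dimension under an injective linear map\<close>

text \<open>The map is linear only on \<open>V\<close>, not on all functions, so independence of images is checked by
  hand: independent subsets of \<open>W\<close> have independent images in \<open>A ` V\<close>, hence at most \<open>n\<close> elements. In
  particular a basis of \<open>W\<close> is finite.\<close>

lemma cdim_le_if_injective: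
  fixes A :: "'d::finite vfun \<Rightarrow> 'd vfun"
  assumes V: "vfun.subspace V" and W: "vfun.subspace W" "W \<subseteq> V"
    and add: "\<And>f g. f \<in> V \<Longrightarrow> g \<in> V \<Longrightarrow> A (f + g) = A f + A g"
    and scale: "\<And>c f. f \<in> V \<Longrightarrow> A (vscale c f) = vscale c (A f)"
    and inj: "\<And>f. f \<in> W \<Longrightarrow> A f = 0 \<Longrightarrow> f = 0"
    and dim: "cdim (A ` V) = enat n"
  shows "cdim W \<le> enat n"
proof -
  obtain D where D: "finite D" "A ` V \<subseteq> vfun.span D" and n: "vfun.dim (A ` V) = n"
    using dim unfolding cdim_def by (auto split: if_splits)
  obtain T where T: "T \<subseteq> A ` V" "vfun.independent T" "A ` V \<subseteq> vfun.span T"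
    using vfun.maximal_independent_subset[of "A ` V"] by metis
  have "T \<subseteq> vfun.span D"
    using T(1) D(2) by (rule subset_trans)
  then have finT: "finite T"
    using vfun.independent_span_bound[OF D(1) T(2)] by simp
  have cardT: "card T = n"
    using vfun.basis_card_eq_dim[OF T(1,3,2)] n by simp
  obtain B where B: "B \<subseteq> W" "vfun.independent B" "W \<subseteq> vfun.span B"
    using vfun.maximal_independent_subset[of W] by metis
  have A0: "A 0 = 0"
    using scale[OF vfun.subspace_0[OF V], of 0] by (simp add: vfun.scale_zero_left)
  have A_sum: "A (\<Sum>v\<in>F. vscale (u v) v) = (\<Sum>v\<in>F. vscale (u v) (A v)) \<and> (\<Sum>v\<in>F. vscale (u v) v) \<in> W"
    if "finite F" "F \<subseteq> W" for F u
    using that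
  proof induction
    case empty
    show ?case
      unfolding sum.empty using A0 vfun.subspace_0[OF W(1)] by blast
  next
    case (insert x F)
    have x: "x \<in> W" and F: "A (\<Sum>v\<in>F. vscale (u v) v) = (\<Sum>v\<in>F. vscale (u v) (A v))"
        "(\<Sum>v\<in>F. vscale (u v) v) \<in> W"
      using insert by auto
    have ux: "vscale (u x) x \<in> W"
      using x by (rule vfun.subspace_scale[OF W(1)])
    show ?case
      unfolding sum.insert[OF insert(1,2)] add[OF subsetD[OF W(2) ux] subsetD[OF W(2) F(2)]]
        scale[OF subsetD[OF W(2) x]] F(1)
      using vfun.subspace_add[OF W(1) ux F(2)] by blast
  qed
  have "card F \<le> n" if F: "F \<subseteq> B" "finite F" for F
  proof -
    have FW: "F \<subseteq> W"
      using F B(1) by blast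
    have indF: "vfun.independent F"
      using B(2) F(1) by (rule vfun.independent_mono)
    have injF: "inj_on A F"
    proof (rule inj_onI)
      fix x y assume xy: "x \<in> F" "y \<in> F" "A x = A y"
      have x: "x \<in> W" and y: "y \<in> W"
        using xy FW by auto
      have d: "x - y \<in> W"
        using x y by (rule vfun.subspace_diff[OF W(1)])
      have "A x = A (x - y) + A y"
        using add[OF subsetD[OF W(2) d] subsetD[OF W(2) y]] by simp
      then have "A (x - y) = 0"
        using xy(3) by simp
      then show "x = y"
        using inj[OF d] by simp
    qed
    have "vfun.independent (A ` F)"
    proof
      assume "vfun.dependent (A ` F)"
      then obtain u v where uv: "v \<in> F" "u (A v) \<noteq> 0" "(\<Sum>v\<in>A ` F. vscale (u v) v) = 0"
        using vfun.dependent_finite[of "A ` F"] F(2) by auto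
      have "(\<Sum>v\<in>F. vscale (u (A v)) (A v)) = 0"
        using uv(3) sum.reindex[OF injF, of "\<lambda>v. vscale (u v) v"] by (simp add: o_def)
      then have "A (\<Sum>v\<in>F. vscale (u (A v)) v) = 0" "(\<Sum>v\<in>F. vscale (u (A v)) v) \<in> W"
        using A_sum[OF F(2) FW, of "\<lambda>v. u (A v)"] by simp_all
      then have zero: "(\<Sum>v\<in>F. vscale (u (A v)) v) = 0"
        using inj by blast
      have "\<exists>v\<in>F. u (A v) \<noteq> 0"
        using uv(1,2) by blast
      with zero have "vfun.dependent F"
        unfolding vfun.dependent_finite[OF F(2)] by (intro exI[of _ "\<lambda>v. u (A v)"]) simp
      with indF show False ..
    qed
    moreover have "A ` F \<subseteq> vfun.span T"
      using FW W(2) T(3) by blast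
    ultimately have "card (A ` F) \<le> card T"
      using vfun.independent_span_bound[OF finT] by blast
    then show ?thesis
      using card_image[OF injF] cardT by simp
  qed
  then have fin: "finite B" "card B \<le> n"
    using finite_if_finite_subsets_card_bdd[of B n] by auto
  have "vfun.dim W = card B"
    using vfun.basis_card_eq_dim[OF B(1,3,2)] by simp
  then show ?thesis
    using fin B(3) unfolding cdim_def by auto
qed


section \<open>The model space and the commutator of the compressed shift\<close>

lemma funpow_mult_z1_in_H2: "f \<in> H2 \<Longrightarrow> (mult_z1 ^^ m) f \<in> H2"
  by (induction m) (simp_all add: mult_z1_in_H2)

lemma funpow_backward_shift_in_H2: "f \<in> H2 \<Longrightarrow> (backward_shift ^^ m) f \<in> H2"
  by (induction m) (simp_all add: backward_shift_in_H2)

lemma H2_ip_funpow_mult_z1: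
  "f \<in> H2 \<Longrightarrow> g \<in> H2 \<Longrightarrow> H2_ip ((mult_z1 ^^ m) f) g = H2_ip f ((backward_shift ^^ m) g)"
proof (induction m arbitrary: g)
  case (Suc m)
  then show ?case
    by (simp add: H2_ip_mult_z1_left funpow_mult_z1_in_H2 backward_shift_in_H2)
       (simp only: funpow_swap1)
qed simp

locale inner_model =
  fixes \<Theta> :: "'d::finite mfun"
  assumes inner: "inner_function \<Theta>"
begin

abbreviation K where "K \<equiv> model_space \<Theta>"
abbreviation S where "S \<equiv> S1max \<Theta>"
abbreviation W where "W \<equiv> S \<ominus> mult_z1 ` S"

definition range_space :: "'d vfun set" where
  "range_space = (\<lambda>f z. \<Theta> z *v f z) ` H2"

lemma range_space_subset: "range_space \<subseteq> H2"
  unfolding range_space_def using inner_function_multiplier[OF inner] by blast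

lemma mult_z1_range_space:
  assumes "g \<in> range_space"
  shows "mult_z1 g \<in> range_space"
proof -
  obtain f where f: "f \<in> H2" "g = (\<lambda>z. \<Theta> z *v f z)"
    using assms by (auto simp: range_space_def)
  have "mult_z1 g = (\<lambda>z. \<Theta> z *v mult_z1 f z)"
    by (simp add: f(2) mult_z1_def fun_eq_iff vec_eq_iff matrix_vector_mult_def sum_distrib_left mult_ac)
  then show ?thesis
    using mult_z1_in_H2[OF f(1)] by (auto simp: range_space_def)
qed

lemma K_eq: "K = H2 \<ominus> range_space"
  by (simp add: model_space_def range_space_def)

lemma K_subset: "K \<subseteq> H2"
  by (auto simp: K_eq orth_compl_def)

lemma hilbert_K: "hilbert_space_on K H2_ip"
  unfolding K_eq by (rule hilbert_space_on_orth_compl[OF hilbert_space_on_H2 range_space_subset])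

lemma backward_shift_K:
  assumes f: "f \<in> K"
  shows "backward_shift f \<in> K"
proof -
  have fH: "f \<in> H2"
    using f K_subset by blast
  have "H2_ip (backward_shift f) g = 0" if g: "g \<in> range_space" for g
  proof -
    have gH: "g \<in> H2"
      using g range_space_subset by blast
    have "H2_ip f (mult_z1 g) = 0"
      using f mult_z1_range_space[OF g] by (simp add: K_eq orth_compl_def)
    then have "H2_ip g (backward_shift f) = 0"
      using H2.ip_commute[OF fH mult_z1_in_H2[OF gH]] H2_ip_mult_z1_left[OF gH fH] by simp
    then show ?thesis
      using H2.ip_commute[OF gH backward_shift_in_H2[OF fH]] by simp
  qed
  then show ?thesis
    using backward_shift_in_H2[OF fH] by (simp add: K_eq orth_compl_def)
qed

text \<open>Moving the powers of the shift to the other side of the inner product shows that the invariant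
  subspace is an orthogonal complement, hence closed.\<close>

lemma S_eq: "S = H2 \<ominus> (\<Union>m. (backward_shift ^^ m) ` range_space)"
proof (rule set_eqI)
  fix f
  have step: "(mult_z1 ^^ m) f \<in> K \<longleftrightarrow> (\<forall>g\<in>range_space. H2_ip f ((backward_shift ^^ m) g) = 0)"
    if "f \<in> H2" for m
    using H2_ip_funpow_mult_z1[OF that subsetD[OF range_space_subset]] funpow_mult_z1_in_H2[OF that]
    by (simp add: K_eq orth_compl_def)
  show "f \<in> S \<longleftrightarrow> f \<in> H2 \<ominus> (\<Union>m. (backward_shift ^^ m) ` range_space)"
  proof (cases "f \<in> H2")
    case True
    then show ?thesis
      by (simp add: S1max_def step orth_compl_def)
  next
    case False
    have "f \<notin> S"
    proof
      assume "f \<in> S"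
      then have "(mult_z1 ^^ 0) f \<in> K"
        unfolding S1max_def by blast
      with False K_subset show False by auto
    qed
    with False show ?thesis
      by (simp add: orth_compl_def)
  qed
qed

lemma S_subset_K: "S \<subseteq> K"
proof
  fix f assume "f \<in> S"
  then have "(mult_z1 ^^ 0) f \<in> K"
    unfolding S1max_def by blast
  then show "f \<in> K" by simp
qed

lemma S_subset: "S \<subseteq> H2"
  using S_subset_K K_subset by (rule subset_trans)

lemma hilbert_S: "hilbert_space_on S H2_ip"
  unfolding S_eq using range_space_subset funpow_backward_shift_in_H2
  by (intro hilbert_space_on_orth_compl[OF hilbert_space_on_H2]) blast

lemma mult_z1_S:
  assumes "f \<in> S"
  shows "mult_z1 f \<in> S"
proof -
  have "(mult_z1 ^^ m) (mult_z1 f) \<in> K" for m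
  proof -
    have "(mult_z1 ^^ Suc m) f \<in> K"
      using assms unfolding S1max_def by blast
    then show ?thesis
      by (simp only: funpow.simps o_apply funpow_swap1)
  qed
  then show ?thesis
    by (simp add: S1max_def)
qed

lemma S_if_mult_z1_S:
  assumes "g \<in> K" "mult_z1 g \<in> S"
  shows "g \<in> S"
proof -
  have "(mult_z1 ^^ m) g \<in> K" for m
  proof (cases m)
    case (Suc l)
    then show ?thesis
      using assms(2) by (simp add: S1max_def funpow_swap1)
  qed (use assms(1) in simp)
  then show ?thesis
    by (simp add: S1max_def)
qed

lemma mult_z1_image_S: "mult_z1 ` S \<subseteq> S"
  using mult_z1_S by blast

lemma W_subset_S: "W \<subseteq> S"
  by (auto simp: orth_compl_def)

lemma hilbert_W: "hilbert_space_on W H2_ip"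
  by (rule hilbert_space_on_orth_compl[OF hilbert_S mult_z1_image_S])


subsection \<open>The commutator\<close>

abbreviation P where "P \<equiv> orth_proj K"
abbreviation commutator where "commutator \<equiv> self_commutator K (compressed_shift \<Theta>)"

interpretation K: function_hilbert_space K H2_ip
  by unfold_locales (rule hilbert_K)

lemmas P_in = orth_proj_in[OF hilbert_K K_subset]
lemmas P_ip = H2_ip_orth_proj[OF hilbert_K K_subset]
lemmas P_eqI = orth_proj_eqI[OF hilbert_K K_subset]
lemmas K_H2 = subsetD[OF K_subset]

text \<open>The backward shift leaves \<open>K\<close> invariant and \<open>P\<close> disappears in inner products with elements of
  \<open>K\<close>.\<close>

lemma hadjoint_compressed_shift:
  assumes g: "g \<in> K"
  shows "hadjoint K (compressed_shift \<Theta>) g = backward_shift g"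
proof (rule hadjoint_eqI[OF K.subspace_V K_subset backward_shift_K[OF g]])
  fix f assume f: "f \<in> K"
  show "H2_ip (compressed_shift \<Theta> f) g = H2_ip f (backward_shift g)"
    unfolding compressed_shift_def
    by (simp only: P_ip[OF mult_z1_in_H2[OF K_H2[OF f]] g] H2_ip_mult_z1_left[OF K_H2[OF f] K_H2[OF g]])
qed

lemma commutator_eq:
  assumes f: "f \<in> K"
  shows "commutator f = P (mult_z1 (backward_shift f)) - backward_shift (P (mult_z1 f))"
  using hadjoint_compressed_shift[OF f] hadjoint_compressed_shift[OF P_in[OF mult_z1_in_H2[OF K_H2[OF f]]]]
  by (simp add: self_commutator_def compressed_shift_def)

lemma commutator_add:
  assumes f: "f \<in> K" and g: "g \<in> K"
  shows "commutator (f + g) = commutator f + commutator g"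
proof -
  note H = K_H2[OF f] K_H2[OF g]
  note P_add = orth_proj_add[OF hilbert_K K_subset]
  have "P (mult_z1 (backward_shift (f + g))) = P (mult_z1 (backward_shift f)) + P (mult_z1 (backward_shift g))"
    by (simp only: backward_shift_add[OF H] mult_z1_add
        P_add[OF mult_z1_in_H2[OF backward_shift_in_H2[OF H(1)]] mult_z1_in_H2[OF backward_shift_in_H2[OF H(2)]]])
  moreover have "backward_shift (P (mult_z1 (f + g))) = backward_shift (P (mult_z1 f)) + backward_shift (P (mult_z1 g))"
    by (simp only: mult_z1_add P_add[OF H[THEN mult_z1_in_H2]]
        backward_shift_add[OF H[THEN mult_z1_in_H2, THEN P_in, THEN K_H2]])
  ultimately show ?thesis
    by (simp only: commutator_eq[OF K.add_mem[OF f g]] commutator_eq[OF f] commutator_eq[OF g] add_diff_add)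
qed

lemma commutator_scale:
  assumes f: "f \<in> K"
  shows "commutator (vscale c f) = vscale c (commutator f)"
proof -
  note H = K_H2[OF f]
  note P_scale = orth_proj_scale[OF hilbert_K K_subset]
  show ?thesis
    by (simp only: commutator_eq[OF K.scale_mem[OF f]] commutator_eq[OF f] backward_shift_scale[OF H]
        mult_z1_scale P_scale[OF mult_z1_in_H2[OF backward_shift_in_H2[OF H]]] P_scale[OF mult_z1_in_H2[OF H]]
        backward_shift_scale[OF K_H2[OF P_in[OF mult_z1_in_H2[OF H]]]] vfun.scale_right_diff_distrib)
qed

lemma P_fix: "f \<in> K \<Longrightarrow> P f = f"
  by (rule P_eqI[OF K_H2]) auto

text \<open>If the commutator kills \<open>f\<close>, the backward shift does not decrease the norm of \<open>f\<close>, which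
  forces \<open>f\<close> to be \<open>z\<^sub>1\<close> times its backward shift.\<close>

theorem commutator_injective_on_W:
  assumes f: "f \<in> W" and zero: "commutator f = 0"
  shows "f = 0"
proof -
  have fS: "f \<in> S"
    using f W_subset_S by blast
  have fK: "f \<in> K"
    using fS S_subset_K by blast
  note fH = K_H2[OF fK]
  let ?g = "backward_shift f"
  have gK: "?g \<in> K"
    by (rule backward_shift_K[OF fK])
  note gH = K_H2[OF gK]
  have "mult_z1 f \<in> K"
    using mult_z1_S[OF fS] S_subset_K by blast
  \<comment> \<open>The second term of the commutator is \<open>f\<close> itself, as \<open>P\<close> fixes \<open>z\<^sub>1 f\<close>.\<close>
  then have "P (mult_z1 ?g) = f"
    using zero commutator_eq[OF fK] by (simp add: P_fix backward_shift_mult_z1[OF fH])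
  then have "H2_ip f f = H2_ip (mult_z1 ?g) f"
    using P_ip[OF mult_z1_in_H2[OF gH] fK] by simp
  also have "\<dots> = H2_ip ?g ?g"
    by (rule H2_ip_mult_z1_left[OF gH fH])
  finally have norms: "H2.nsq f = H2.nsq ?g" "H2_ip (mult_z1 ?g) f = H2_ip ?g ?g"
    using H2_ip_mult_z1_left[OF gH fH] by (simp_all add: H2.nsq_def)
  have "H2.nsq (mult_z1 ?g - f) = H2.nsq (mult_z1 ?g) + H2.nsq f - 2 * Re (H2_ip (mult_z1 ?g) f)"
    by (rule H2.nsq_diff[OF mult_z1_in_H2[OF gH] fH])
  also have "\<dots> = 0"
    using norms H2_ip_mult_z1_mult_z1[OF gH gH] by (simp add: H2.nsq_def)
  finally have eq: "mult_z1 ?g = f"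
    using H2.nsq_eq_0_iff[OF H2_diff[OF mult_z1_in_H2[OF gH] fH]] by simp
  then have "?g \<in> S"
    using S_if_mult_z1_S[OF gK] fS by simp
  with f have "H2_ip f (mult_z1 ?g) = 0"
    by (simp add: orth_compl_def)
  then have "H2_ip f f = 0"
    unfolding eq .
  then show ?thesis
    by (rule H2.ip_self_eq_0[OF fH])
qed


subsection \<open>The wandering subspace as a reproducing kernel space\<close>

interpretation S: function_hilbert_space S H2_ip
  by unfold_locales (rule hilbert_S)

text \<open>Let \<open>L\<close> be \<open>1 - z\<^sub>1 w\<^sub>1*\<close> times the reproducing kernel \<open>k\<close> of \<open>S\<close>. Its kernel functions are those of
  \<open>k\<close> minus \<open>w\<^sub>1* z\<^sub>1\<close> times themselves. As multiplication by \<open>z\<^sub>1\<close> is isometric and \<open>z\<^sub>1 g\<close> takes the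
  value \<open>w\<^sub>1 g(w)\<close> at \<open>w\<close>, they are orthogonal to \<open>z\<^sub>1 S\<close>; on \<open>W\<close>, which is orthogonal to \<open>z\<^sub>1 S\<close>, the
  subtracted term does not contribute, so \<open>L\<close> reproduces \<open>W\<close>. This yields positivity of \<open>L\<close> as
  well, and \<open>L\<close> is the only candidate for the maximal kernel since the reproducing kernel of \<open>S\<close> is
  unique.\<close>

theorem RKHS_K1max: "RKHS (K1max \<Theta>) = W"
proof -
  obtain k where k: "has_reproducing_kernel S H2_ip k"
    using closed_subspace_has_reproducing_kernel[OF hilbert_S S_subset] by blast
  define L :: "'d kernel" where
    "L z w = (if z \<in> bidisk \<and> w \<in> bidisk then (\<chi> i j. (1 - fst z * cnj (fst w)) * k z w $ i $ j) else 0)"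
    for z w
  have L_off: "L z w = 0" if "(z, w) \<notin> bidisk \<times> bidisk" for z w
    using that by (auto simp: L_def)
  have nz: "1 - fst z * cnj (fst w) \<noteq> 0" if "z \<in> bidisk" "w \<in> bidisk" for z w
  proof -
    have "norm (fst z * cnj (fst w)) < 1"
      using that mult_strict_mono'[of "norm (fst z)" 1 "norm (fst w)" 1]
      by (simp add: mem_bidisk_iff norm_mult)
    then show ?thesis by auto
  qed
  have L_eq: "(\<lambda>z. L z w *v \<eta>) = (\<lambda>z. k z w *v \<eta>) - vscale (cnj (fst w)) (mult_z1 (\<lambda>z. k z w *v \<eta>))"
    if w: "w \<in> bidisk" for w \<eta>
  proof
    fix z
    show "(L z w *v \<eta>) = ((\<lambda>z. k z w *v \<eta>) - vscale (cnj (fst w)) (mult_z1 (\<lambda>z. k z w *v \<eta>))) z"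
    proof (cases "z \<in> bidisk")
      case True
      have "(\<chi> i j. a * k z w $ i $ j) *v \<eta> = a *s (k z w *v \<eta>)" for a
        by (simp add: vec_eq_iff matrix_vector_mult_def sum_distrib_left mult.assoc)
      then have "L z w *v \<eta> = (1 - fst z * cnj (fst w)) *s (k z w *v \<eta>)"
        using True w by (simp only: L_def simp_thms if_True)
      also have "(1 - a * b) *s x = x - b *s (a *s x)" for a b :: complex and x :: "complex ^ 'd"
        by (simp add: vec_eq_iff algebra_simps)
      finally show ?thesis
        by (simp add: vscale_def mult_z1_def)
    next
      case False
      have "k z w *v \<eta> = 0"
        by (rule reproducing_kernel_off[OF k reproducing_kernel_in[OF k w] False])
      then show ?thesis
        using False by (simp add: L_def vscale_def mult_z1_def)
    qed
  qed
  have RK_W: "has_reproducing_kernel W H2_ip L"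
    unfolding has_reproducing_kernel_def
  proof (intro conjI ballI allI impI)
    show "hilbert_space_on W H2_ip"
      by (rule hilbert_W)
    show "f z = 0" if "f \<in> W" "z \<notin> bidisk" for f z
      using reproducing_kernel_off[OF k] W_subset_S that by blast
    fix w :: "complex \<times> complex" and \<eta> :: "complex ^ 'd"
    assume w: "w \<in> bidisk"
    let ?k = "\<lambda>z. k z w *v \<eta>"
    have kS: "?k \<in> S"
      by (rule reproducing_kernel_in[OF k w])
    have zkS: "vscale (cnj (fst w)) (mult_z1 ?k) \<in> S"
      by (intro S.scale_mem mult_z1_S kS)
    have ip: "H2_ip f (\<lambda>z. L z w *v \<eta>) = cip (f w) \<eta> - fst w * H2_ip f (mult_z1 ?k)" if f: "f \<in> S" for f
    proof -
      have "H2_ip f (\<lambda>z. L z w *v \<eta>) = H2_ip f ?k - H2_ip f (vscale (cnj (fst w)) (mult_z1 ?k))"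
        unfolding L_eq[OF w] by (rule S.ip_diff_right[OF f kS zkS])
      then show ?thesis
        using reproducing_kernel_ip[OF k w f] S.ip_scale_right[OF f mult_z1_S[OF kS]] by simp
    qed
    have LS: "(\<lambda>z. L z w *v \<eta>) \<in> S"
      unfolding L_eq[OF w] by (rule S.diff_mem[OF kS zkS])
    have "H2_ip (\<lambda>z. L z w *v \<eta>) (mult_z1 g) = 0" if g: "g \<in> S" for g
    proof -
      have "H2_ip (mult_z1 g) (mult_z1 ?k) = cip (g w) \<eta>"
        using H2_ip_mult_z1_mult_z1[OF subsetD[OF S_subset g] subsetD[OF S_subset kS]]
          reproducing_kernel_ip[OF k w g] by simp
      then have "H2_ip (mult_z1 g) (\<lambda>z. L z w *v \<eta>) = 0"
        using ip[OF mult_z1_S[OF g]] by (simp add: mult_z1_def cip_scale_left)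
      then show ?thesis
        using S.ip_commute[OF mult_z1_S[OF g] LS] by simp
    qed
    with LS show "(\<lambda>z. L z w *v \<eta>) \<in> W"
      by (auto simp: orth_compl_def)
    fix f assume f: "f \<in> W"
    then have "H2_ip f (mult_z1 ?k) = 0"
      using kS by (simp add: orth_compl_def)
    then show "H2_ip f (\<lambda>z. L z w *v \<eta>) = cip (f w) \<eta>"
      using ip[OF subsetD[OF W_subset_S f]] by simp
  qed
  have quotient: "(\<lambda>z. (\<chi> i j. L z w $ i $ j / (1 - fst z * cnj (fst w))) *v \<eta>) = (\<lambda>z. k z w *v \<eta>)"
    if w: "w \<in> bidisk" for w \<eta>
  proof
    fix z
    show "(\<chi> i j. L z w $ i $ j / (1 - fst z * cnj (fst w))) *v \<eta> = k z w *v \<eta>"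
    proof (cases "z \<in> bidisk")
      case True
      then show ?thesis
        using w nz[OF True w] by (simp add: L_def matrix_vector_mult_def)
    next
      case False
      then show ?thesis
        using reproducing_kernel_off[OF k reproducing_kernel_in[OF k w] False]
        by (simp add: L_def vec_eq_iff matrix_vector_mult_def)
    qed
  qed
  have RK_S: "has_reproducing_kernel S H2_ip (\<lambda>z w. \<chi> i j. L z w $ i $ j / (1 - fst z * cnj (fst w)))"
    using k quotient unfolding has_reproducing_kernel_def by simp
  have "K1max \<Theta> = L"
    unfolding K1max_def
  proof (rule the_equality)
    show "positive_kernel L \<and> has_reproducing_kernel S H2_ip
        (\<lambda>z w. \<chi> i j. L z w $ i $ j / (1 - fst z * cnj (fst w)))"
      using positive_kernel_if_reproducing[OF RK_W L_off] RK_S by blast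
    fix L' :: "'d kernel"
    assume L': "positive_kernel L' \<and> has_reproducing_kernel S H2_ip
        (\<lambda>z w. \<chi> i j. L' z w $ i $ j / (1 - fst z * cnj (fst w)))"
    show "L' = L"
    proof (intro ext)
      fix z w
      show "L' z w = L z w"
      proof (cases "z \<in> bidisk \<and> w \<in> bidisk")
        case True
        have "(\<chi> i j. L' z w $ i $ j / (1 - fst z * cnj (fst w))) =
            (\<chi> i j. L z w $ i $ j / (1 - fst z * cnj (fst w)))"
          using reproducing_kernel_unique[OF conjunct2[OF L'] RK_S, of w z] True by simp
        then show ?thesis
          using nz[of z w] True by (simp add: vec_eq_iff)
      next
        case False
        then have "L' z w = 0"
          using L' unfolding positive_kernel_def by blast
        then show ?thesis
          using L_off[of z w] False by simp
      qed
    qed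
  qed
  then show ?thesis
    using RKHS_eq[OF RK_W] by simp
qed

theorem cdim_W_le:
  assumes "oprank K commutator = enat n"
  shows "cdim W \<le> enat n"
proof (rule cdim_le_if_injective)
  show "vfun.subspace K"
    by (rule K.subspace_V)
  show "vfun.subspace W"
    using hilbert_W by (simp add: hilbert_space_on_def)
  show "W \<subseteq> K"
    using W_subset_S S_subset_K by (rule subset_trans)
  show "cdim (commutator ` K) = enat n"
    using assms by (simp add: oprank_def)
qed (fact commutator_add commutator_scale commutator_injective_on_W)+

end

theorem theorem2p3:
  fixes \<Theta> :: "complex \<times> complex \<Rightarrow> complex ^ 'd ^ 'd" and n :: nat
  assumes "inner_function \<Theta>"
    and "oprank (model_space \<Theta>) (self_commutator (model_space \<Theta>) (compressed_shift \<Theta>)) = enat n"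
  shows "cdim (RKHS (K1max \<Theta>)) \<le> enat n"
proof -
  interpret inner_model \<Theta>
    by unfold_locales fact
  show ?thesis
    unfolding RKHS_K1max using assms(2) by (rule cdim_W_le)
qed

end
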